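(* Let $n\in\omega$. There exists a computable connected directed graph $G$ whose directed distance function is intrinsically $n$-approximable from above, yet such that every total function $f:\omega\to\omega$ which is $n$-approximable from above is $1$-btt-equivalent to the directed distance function on some computable directed graph isomorphic to $G$.
   Context: A directed graph is computable if its domain is $\omega$ or a finite initial segment of $\omega$ and its (oriented) edge relation is computable. A directed path from $x$ to $y$ is a sequence $x=x_0,\dots,x_k=y$ with an edge from each $x_i$ to $x_{i+1}$; the directed graph is connected if there is a directed path from every node to every other node, and then the directed distance from $x$ to $y$ is the length of a shortest directed path from $x$ to $y$, regarded as a function on $\omega$ via a fixed computable pairing. A total $h$ is $n$-approximable from above if $h(x)=\lim_s g(x,s)$ for a total computable $g$ with $g(x,s+1)\le g(x,s)$ and $|\{s:g(x,s)\ne g(x,s+1)\}|\le n$ for all $x$. The directed distance function of $G$ is intrinsically $n$-approximable from above if for every computable directed graph $H\cong G$ the directed distance function on $H$ is $n$-approximable from above. For total $\alpha,\beta$, with $D_e$ the finite set of canonical index $e$: $\alpha\le_{1\text{-btt}}\beta$ if there are total computable $p,q$ with $|D_{p(x)}|\le 1$ and $\alpha(x)=q(x,\beta\restriction D_{p(x)})$ for all $x$; $1$-btt-equivalence means reducibility in both directions. *)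

theory Defs
  imports
    Complex_Main
    "HOL-Library.Nat_Bijection"
    "Graph_Theory.Pair_Digraph"
    "Graph_Theory.Digraph_Component"
    "Graph_Theory.Digraph_Isomorphism"
    "Graph_Theory.Vertex_Walk"
begin

section \<open>Computable functions\<close>

text \<open>Programs for the partial (mu-)recursive functions: zero, successor, projection,
  composition, primitive recursion (on the first argument) and unbounded search
  (for the first argument).\<close>

datatype prog = Zr | Sc | Pj nat | Cn prog "prog list" | Pr prog prog | Mn prog

text \<open>\<open>computes c xs y\<close>: the program \<open>c\<close> converges on the argument tuple \<open>xs\<close> with output \<open>y\<close>.\<close>

inductive computes :: "prog \<Rightarrow> nat list \<Rightarrow> nat \<Rightarrow> bool" where
  Zr: "computes Zr xs 0"
| Sc: "computes Sc [x] (Suc x)"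
| Pj: "i < length xs \<Longrightarrow> computes (Pj i) xs (xs ! i)"
| Cn: "list_all2 (\<lambda>g y. computes g xs y) gs ys \<Longrightarrow> computes f ys z \<Longrightarrow> computes (Cn f gs) xs z"
| Pr_0: "computes f xs y \<Longrightarrow> computes (Pr f g) (0 # xs) y"
| Pr_Suc: "computes (Pr f g) (k # xs) y \<Longrightarrow> computes g (k # y # xs) z
    \<Longrightarrow> computes (Pr f g) (Suc k # xs) z"
| Mn: "computes f (k # xs) 0 \<Longrightarrow> (\<forall>j<k. \<exists>y>0. computes f (j # xs) y)
    \<Longrightarrow> computes (Mn f) xs k"

inductive_cases computes_ZrE: "computes Zr xs y"
inductive_cases computes_ScE: "computes Sc xs y"
inductive_cases computes_PjE: "computes (Pj i) xs y"
inductive_cases computes_CnE: "computes (Cn f gs) xs y"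
inductive_cases computes_Pr0E: "computes (Pr f g) (0 # xs) y"
inductive_cases computes_PrSucE: "computes (Pr f g) (Suc k # xs) y"
inductive_cases computes_MnE: "computes (Mn f) xs y"

lemma computes_deterministic: "computes c xs y \<Longrightarrow> computes c xs z \<Longrightarrow> y = z"
proof (induction arbitrary: z rule: computes.induct)
  case (Zr xs)
  then show ?case by (rule computes_ZrE) simp
next
  case (Sc x)
  then show ?case by (rule computes_ScE) simp
next
  case (Pj i xs)
  from Pj.prems show ?case by (rule computes_PjE) simp
next
  case (Cn xs gs ys f w)
  from Cn.prems obtain ys' where ys': "list_all2 (\<lambda>g y. computes g xs y) gs ys'"
    and z: "computes f ys' z" by (rule computes_CnE)
  have "ys = ys'"
  proof (rule nth_equalityI)
    show "length ys = length ys'"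
      using Cn.IH(1) ys' by (simp add: list_all2_conv_all_nth)
    show "ys ! i = ys' ! i" if "i < length ys" for i
      using Cn.IH(1) ys' that by (simp add: list_all2_conv_all_nth)
  qed
  with z Cn.IH(2) show ?case by blast
next
  case (Pr_0 f xs y g)
  from Pr_0.prems have "computes f xs z" by (rule computes_Pr0E)
  then show ?case by (rule Pr_0.IH)
next
  case (Pr_Suc f g k xs y w)
  from Pr_Suc.prems obtain y' where "computes (Pr f g) (k # xs) y'" "computes g (k # y' # xs) z"
    by (rule computes_PrSucE)
  then show ?case using Pr_Suc.IH by blast
next
  case (Mn f k xs)
  from Mn.prems have z: "computes f (z # xs) 0" "\<forall>j<z. \<exists>y>0. computes f (j # xs) y"
    by (auto elim: computes_MnE)
  have "\<not> z < k"
  proof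
    assume "z < k"
    then obtain y where "y > 0" "\<forall>w. computes f (z # xs) w \<longrightarrow> y = w" using Mn.IH(2) by blast
    with z(1) show False by blast
  qed
  moreover have "\<not> k < z"
  proof
    assume "k < z"
    then obtain y where "y > 0" "computes f (k # xs) y" using z(2) by blast
    then show False using Mn.IH(1) by blast
  qed
  ultimately show ?case by simp
qed

definition computable1 :: "(nat \<Rightarrow> nat) \<Rightarrow> bool" where
  "computable1 f \<longleftrightarrow> (\<exists>c. \<forall>x. computes c [x] (f x))"

definition computable2 :: "(nat \<Rightarrow> nat \<Rightarrow> nat) \<Rightarrow> bool" where
  "computable2 f \<longleftrightarrow> (\<exists>c. \<forall>x y. computes c [x, y] (f x y))"

section \<open>Approximability and reducibility\<close>

definition approx_from_above :: "nat \<Rightarrow> (nat \<Rightarrow> nat) \<Rightarrow> bool" where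
  "approx_from_above n h \<longleftrightarrow> (\<exists>g. computable2 g \<and>
     (\<forall>x. g x \<longlonglongrightarrow> h x) \<and>
     (\<forall>x s. g x (Suc s) \<le> g x s) \<and>
     (\<forall>x. finite {s. g x s \<noteq> g x (Suc s)} \<and> card {s. g x s \<noteq> g x (Suc s)} \<le> n))"

text \<open>\<open>set_decode e\<close> is the finite set of canonical index \<open>e\<close>. The finite function
  \<open>\<beta>\<close> restricted to \<open>D\<close> is handed to \<open>q\<close> as the canonical index of its graph.\<close>

definition restr_code :: "(nat \<Rightarrow> nat) \<Rightarrow> nat set \<Rightarrow> nat" where
  "restr_code \<beta> D = set_encode ((\<lambda>i. prod_encode (i, \<beta> i)) ` D)"

definition btt1_le :: "(nat \<Rightarrow> nat) \<Rightarrow> (nat \<Rightarrow> nat) \<Rightarrow> bool" where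
  "btt1_le \<alpha> \<beta> \<longleftrightarrow> (\<exists>p q. computable1 p \<and> computable2 q \<and>
     (\<forall>x. card (set_decode (p x)) \<le> 1 \<and> \<alpha> x = q x (restr_code \<beta> (set_decode (p x)))))"

definition btt1_equiv :: "(nat \<Rightarrow> nat) \<Rightarrow> (nat \<Rightarrow> nat) \<Rightarrow> bool" where
  "btt1_equiv \<alpha> \<beta> \<longleftrightarrow> btt1_le \<alpha> \<beta> \<and> btt1_le \<beta> \<alpha>"

section \<open>Computable directed graphs\<close>

definition computable_digraph :: "nat pair_pre_digraph \<Rightarrow> bool" where
  "computable_digraph G \<longleftrightarrow> pair_wf_digraph G \<and>
     (pverts G = UNIV \<or> (\<exists>m. pverts G = {..<m})) \<and>
     computable2 (\<lambda>x y. of_bool ((x, y) \<in> parcs G))"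

definition isomorphic :: "nat pair_pre_digraph \<Rightarrow> nat pair_pre_digraph \<Rightarrow> bool" where
  "isomorphic G H \<longleftrightarrow> digraph_iso (with_proj G) (with_proj H)"

definition directed_distance :: "nat pair_pre_digraph \<Rightarrow> nat \<Rightarrow> nat \<Rightarrow> nat" where
  "directed_distance G x y =
     (LEAST k. \<exists>p. vwalk p (with_proj G) \<and> hd p = x \<and> last p = y \<and> vwalk_length p = k)"

text \<open>The directed distance of a connected graph as a function on the natural numbers, via the
  Cantor pairing. If the graph is finite, codes of pairs outside its domain get the value 0.\<close>

definition distance_function :: "nat pair_pre_digraph \<Rightarrow> nat \<Rightarrow> nat" where
  "distance_function G z = (case prod_decode z of (x, y) \<Rightarrow>
     if x \<in> pverts G \<and> y \<in> pverts G then directed_distance G x y else 0)"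

definition intrinsically_approx_from_above :: "nat \<Rightarrow> nat pair_pre_digraph \<Rightarrow> bool" where
  "intrinsically_approx_from_above n G \<longleftrightarrow>
     (\<forall>H. computable_digraph H \<and> isomorphic G H \<longrightarrow> approx_from_above n (distance_function H))"

end

theory Submission
  imports Defs
begin

text \<open>Take a hub with an edge from every other vertex, and attach to it components, each consisting
  of a root and of paths from the hub to the root: for a set \<open>S\<close> of numbers one path of length
  \<open>a + 2\<close> for every \<open>a \<in> S\<close>. The distance from the hub to the root is \<open>Min S + 2\<close>. Let \<open>G\<close> have
  infinitely many components for every \<open>S\<close> with at most \<open>n + 1\<close> elements. Adding, for an
  approximation \<open>g\<close> of \<open>f\<close>, a component with \<open>S = {g x 0, g x 1, \<dots>}\<close> for every \<open>x\<close> does not change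
  the isomorphism type, and in the resulting copy \<open>f\<close> and the distance function compute each other
  with one query, because every distance depends on the component of its target only. In an
  arbitrary copy, one searches for walks that never return to their starting point and use the hub
  at most in one of the first two positions; between given vertices only \<open>n + 1\<close> lengths of such
  walks occur, so the length of the shortest walk found so far decreases at most \<open>n\<close> times.\<close>

section \<open>Computability of expressions\<close>

text \<open>An expression in \<open>n\<close> variables is a function of an environment \<open>e\<close>; entering the
  scope of a bound variable shifts the environment.\<close>

definition recf :: "nat \<Rightarrow> ((nat \<Rightarrow> nat) \<Rightarrow> nat) \<Rightarrow> bool" where
  "recf n F \<longleftrightarrow> (\<exists>c. \<forall>e. computes c (map e [0..<n]) (F e))"

abbreviation decf :: "nat \<Rightarrow> ((nat \<Rightarrow> nat) \<Rightarrow> bool) \<Rightarrow> bool" where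
  "decf n P \<equiv> recf n (\<lambda>e. of_bool (P e))"

lemma recf_proj: "i < n \<Longrightarrow> recf n (\<lambda>e. e i)"
  unfolding recf_def
  by (rule exI[of _ "Pj i"], rule allI, use computes.Pj[of i "map _ [0..<n]"] in simp)

lemma recf_comp:
  assumes F: "recf m F" and B: "\<And>i. i < m \<Longrightarrow> recf n (B i)"
  shows "recf n (\<lambda>e. F (\<lambda>i. B i e))"
proof -
  obtain c where c: "\<And>e. computes c (map e [0..<m]) (F e)"
    using F unfolding recf_def by blast
  obtain b where b: "\<And>i e. i < m \<Longrightarrow> computes (b i) (map e [0..<n]) (B i e)"
    using B unfolding recf_def by metis
  have "computes (Cn c (map b [0..<m])) (map e [0..<n]) (F (\<lambda>i. B i e))" for e
  proof (rule computes.Cn)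
    show "list_all2 (\<lambda>g. computes g (map e [0..<n])) (map b [0..<m])
      (map (\<lambda>i. B i e) [0..<m])"
      by (simp add: list_all2_conv_all_nth b)
  qed (rule c)
  then show ?thesis unfolding recf_def by blast
qed

lemma computable1_iff_recf: "computable1 f \<longleftrightarrow> recf (Suc 0) (\<lambda>e. f (e 0))"
proof
  assume "recf (Suc 0) (\<lambda>e. f (e 0))"
  then obtain c where c: "\<And>e. computes c (map e [0..<Suc 0]) (f (e 0))"
    unfolding recf_def by blast
  have "computes c [x] (f x)" for x
    using c[of "\<lambda>_. x"] by simp
  then show "computable1 f" unfolding computable1_def by blast
qed (auto simp: computable1_def recf_def)

lemma computable2_iff_recf: "computable2 f \<longleftrightarrow> recf (Suc (Suc 0)) (\<lambda>e. f (e 0) (e (Suc 0)))"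
proof
  assume "computable2 f"
  then show "recf (Suc (Suc 0)) (\<lambda>e. f (e 0) (e (Suc 0)))"
    unfolding computable2_def recf_def by (auto simp: upt_rec)
next
  assume "recf (Suc (Suc 0)) (\<lambda>e. f (e 0) (e (Suc 0)))"
  then obtain c where c: "\<And>e. computes c (map e [0..<Suc (Suc 0)]) (f (e 0) (e (Suc 0)))"
    unfolding recf_def by blast
  have "computes c [x, y] (f x y)" for x y
    using c[of "\<lambda>i. if i = 0 then x else y"] by (simp add: upt_rec)
  then show "computable2 f" unfolding computable2_def by blast
qed

lemma recf_comp1: "computable1 f \<Longrightarrow> recf n A \<Longrightarrow> recf n (\<lambda>e. f (A e))"
  unfolding computable1_iff_recf
  using recf_comp[of "Suc 0" "\<lambda>e. f (e 0)" n "\<lambda>_. A"] by simp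

lemma recf_comp2:
  assumes "computable2 f" "recf n A" "recf n B"
  shows "recf n (\<lambda>e. f (A e) (B e))"
  using recf_comp[OF assms(1)[unfolded computable2_iff_recf], of n "\<lambda>i. if i = 0 then A else B"]
    assms(2,3) by simp

lemma recf_Suc:
  assumes "recf n A"
  shows "recf n (\<lambda>e. Suc (A e))"
proof (rule recf_comp1[OF _ assms])
  show "computable1 Suc" unfolding computable1_def using computes.Sc by blast
qed

lemma recf_const: "recf n (\<lambda>_. k)"
proof (induction k)
  case 0
  show ?case unfolding recf_def using computes.Zr by blast
qed (rule recf_Suc)

text \<open>The counter and the previous value are variables 0 and 1 of \<open>G\<close>, the
  argument order of \<open>Pr\<close>. The counter is first an extra variable 0, then
  \<open>H\<close> is substituted for it.\<close>

lemma recf_rec_nat: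
  assumes A: "recf n A" and H: "recf n H"
    and G: "recf (Suc (Suc n)) (\<lambda>e. G (e 0) (e (Suc 0)) (\<lambda>i. e (Suc (Suc i))))"
  shows "recf n (\<lambda>e. rec_nat (A e) (\<lambda>k y. G k y e) (H e))"
proof -
  obtain a where a: "\<And>e. computes a (map e [0..<n]) (A e)"
    using A unfolding recf_def by blast
  obtain g where g: "\<And>e. computes g (map e [0..<Suc (Suc n)])
      (G (e 0) (e (Suc 0)) (\<lambda>i. e (Suc (Suc i))))"
    using G unfolding recf_def by blast
  have g': "computes g (k # y # map e [0..<n]) (G k y e)" for k y e
    using g[of "case_nat k (case_nat y e)"]
    by (simp add: map_upt_Suc del: upt_Suc)
  have r: "computes (Pr a g) (k # map e [0..<n]) (rec_nat (A e) (\<lambda>k y. G k y e) k)" for k e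
    by (induction k) (auto intro: computes.intros a g')
  have "recf (Suc n) (\<lambda>e. rec_nat (A (\<lambda>i. e (Suc i))) (\<lambda>k y. G k y (\<lambda>i. e (Suc i))) (e 0))"
    unfolding recf_def
  proof (intro exI[of _ "Pr a g"] allI)
    fix e
    show "computes (Pr a g) (map e [0..<Suc n])
        (rec_nat (A (\<lambda>i. e (Suc i))) (\<lambda>k y. G k y (\<lambda>i. e (Suc i))) (e 0))"
      using r[of "e 0" "\<lambda>i. e (Suc i)"] by (simp add: map_upt_Suc del: upt_Suc)
  qed
  from recf_comp[OF this, of n "\<lambda>i. case i of 0 \<Rightarrow> H | Suc i \<Rightarrow> \<lambda>e. e i"]
  show ?thesis using H by (auto simp: recf_proj split: nat.splits)
qed

text \<open>\<open>Mn\<close> searches for a zero, so the program has to decide the negation of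
  \<open>P\<close>, whose truth value is 0 exactly at a solution.\<close>

lemma recf_Least:
  assumes P: "decf (Suc n) (\<lambda>e. \<not> P (e 0) (\<lambda>i. e (Suc i)))" and ex: "\<And>e. \<exists>k. P k e"
  shows "recf n (\<lambda>e. LEAST k. P k e)"
proof -
  obtain c where c: "\<And>e. computes c (map e [0..<Suc n]) (of_bool (\<not> P (e 0) (\<lambda>i. e (Suc i))))"
    using P unfolding recf_def by blast
  have c': "computes c (k # map e [0..<n]) (of_bool (\<not> P k e))" for k e
    using c[of "case_nat k e"] by (simp add: map_upt_Suc del: upt_Suc)
  have "computes (Mn c) (map e [0..<n]) (LEAST k. P k e)" for e
  proof (rule computes.Mn)
    show "computes c ((LEAST k. P k e) # map e [0..<n]) 0"
      using c'[of "LEAST k. P k e" e] LeastI_ex[OF ex[of e]] by simp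
    show "\<forall>j<LEAST k. P k e. \<exists>y>0. computes c (j # map e [0..<n]) y"
    proof (intro allI impI)
      fix j assume "j < (LEAST k. P k e)"
      then have "\<not> P j e" by (rule not_less_Least)
      with c'[of j e] show "\<exists>y>0. computes c (j # map e [0..<n]) y" by auto
    qed
  qed
  then show ?thesis unfolding recf_def by blast
qed

section \<open>Arithmetic, Boolean combinations and bounded quantification\<close>

lemma recf_add:
  assumes "recf n A" "recf n B"
  shows "recf n (\<lambda>e. A e + B e)"
proof -
  have "x + y = rec_nat x (\<lambda>_. Suc) y" for x y :: nat by (induction y) auto
  then show ?thesis
    using assms by (simp only:) (intro recf_rec_nat recf_Suc recf_proj; simp)
qed

lemma recf_mult:
  assumes "recf n A" "recf n B"
  shows "recf n (\<lambda>e. A e * B e)"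
proof -
  have "computable2 (\<lambda>x y. rec_nat 0 (\<lambda>_ z. z + x) y)"
    unfolding computable2_iff_recf by (intro recf_rec_nat recf_const recf_proj recf_add) auto
  moreover have "(\<lambda>x y. rec_nat 0 (\<lambda>_ z. z + x) y) = (\<lambda>x y :: nat. x * y)"
  proof (intro ext)
    show "rec_nat 0 (\<lambda>_ z. z + x) y = x * y" for x y :: nat by (induction y) auto
  qed
  ultimately show ?thesis using recf_comp2[OF _ assms] by simp
qed

lemma recf_diff:
  assumes "recf n A" "recf n B"
  shows "recf n (\<lambda>e. A e - B e)"
proof -
  have "computable1 (\<lambda>x. rec_nat 0 (\<lambda>k _. k) x)"
    unfolding computable1_iff_recf by (intro recf_rec_nat recf_const recf_proj) auto
  moreover have "(\<lambda>x. rec_nat 0 (\<lambda>k _. k) x) = (\<lambda>x. x - 1)"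
  proof
    show "rec_nat 0 (\<lambda>k _. k) x = x - 1" for x by (cases x) auto
  qed
  ultimately have pred: "computable1 (\<lambda>x. x - 1)" by simp
  have "computable2 (\<lambda>x y. rec_nat x (\<lambda>_ z. z - 1) y)"
    unfolding computable2_iff_recf
    by (intro recf_rec_nat recf_const recf_proj recf_comp1[OF pred]) auto
  moreover have "(\<lambda>x y. rec_nat x (\<lambda>_ z. z - 1) y) = (\<lambda>x y. x - y)"
  proof (intro ext)
    show "rec_nat x (\<lambda>_ z. z - 1) y = x - y" for x y by (induction y) auto
  qed
  ultimately show ?thesis using recf_comp2[OF _ assms] by simp
qed

lemma recf_power2: "recf n A \<Longrightarrow> recf n (\<lambda>e. 2 ^ A e)"
proof -
  assume "recf n A"
  moreover have "(2 :: nat) ^ x = rec_nat 1 (\<lambda>_ y. y + y) x" for x by (induction x) auto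
  ultimately show ?thesis
    by (simp only:) (intro recf_rec_nat recf_const recf_add recf_proj; simp)
qed

lemma decf_le:
  assumes "recf n A" "recf n B"
  shows "decf n (\<lambda>e. A e \<le> B e)"
proof -
  have "of_bool (x \<le> y) = 1 - (x - y)" for x y :: nat by auto
  then show ?thesis using assms by (simp only:) (intro recf_diff recf_const)
qed

lemma decf_less: "recf n A \<Longrightarrow> recf n B \<Longrightarrow> decf n (\<lambda>e. A e < B e)"
  using decf_le[OF recf_Suc] by (simp add: Suc_le_eq)

lemma decf_not:
  assumes "decf n P"
  shows "decf n (\<lambda>e. \<not> P e)"
proof -
  have "of_bool (\<not> b) = 1 - (of_bool b :: nat)" for b by auto
  then show ?thesis using assms by (simp only:) (intro recf_diff recf_const)
qed

lemma decf_conj: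
  assumes "decf n P" "decf n Q"
  shows "decf n (\<lambda>e. P e \<and> Q e)"
  using recf_mult[OF assms] by (simp add: of_bool_conj)

lemma decf_disj:
  assumes "decf n P" "decf n Q"
  shows "decf n (\<lambda>e. P e \<or> Q e)"
  using decf_not[OF decf_conj[OF decf_not[OF assms(1)] decf_not[OF assms(2)]]] by simp

lemma decf_imp:
  assumes "decf n P" "decf n Q"
  shows "decf n (\<lambda>e. P e \<longrightarrow> Q e)"
  using decf_disj[OF decf_not[OF assms(1)] assms(2)] by (simp only: imp_conv_disj)

lemma decf_eq: "recf n A \<Longrightarrow> recf n B \<Longrightarrow> decf n (\<lambda>e. A e = B e)"
  using decf_conj[OF decf_le decf_le, of n A B B A] by (simp only: order_eq_iff[symmetric])

lemma recf_if:
  assumes "decf n P" "recf n A" "recf n B"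
  shows "recf n (\<lambda>e. if P e then A e else B e)"
proof -
  have "(if b then x else y) = of_bool b * x + of_bool (\<not> b) * y" for b and x y :: nat by simp
  then show ?thesis
    using assms by (simp only:) (intro recf_add recf_mult decf_not)
qed

lemma decf_if:
  assumes "decf n P" "decf n Q" "decf n R"
  shows "decf n (\<lambda>e. if P e then Q e else R e)"
  using recf_if[OF assms] by (simp only: if_distrib[of of_bool])

lemma recf_min: "recf n A \<Longrightarrow> recf n B \<Longrightarrow> recf n (\<lambda>e. min (A e) (B e))"
  unfolding min_def by (intro recf_if decf_le)

text \<open>The truth values are multiplied up by primitive recursion. Variable 1 holds the partial
  product, which \<open>P\<close> skips; hence the shift by two.\<close>

lemma decf_all_less:
  assumes H: "recf n H" and P: "decf (Suc (Suc n)) (\<lambda>e. P (e 0) (\<lambda>i. e (Suc (Suc i))))"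
  shows "decf n (\<lambda>e. \<forall>i<H e. P i e)"
proof -
  have "of_bool (\<forall>i<h. Q i) = rec_nat (1 :: nat) (\<lambda>i y. of_bool (Q i) * y) h" for h and Q :: "nat \<Rightarrow> bool"
    by (induction h) (simp_all add: All_less_Suc of_bool_conj)
  then show ?thesis
    by (simp only:) (intro recf_rec_nat recf_mult recf_const H P recf_proj; simp)
qed

subsection \<open>Cantor pairing\<close>

definition pfst :: "nat \<Rightarrow> nat" where "pfst z = fst (prod_decode z)"
definition psnd :: "nat \<Rightarrow> nat" where "psnd z = snd (prod_decode z)"

lemma pfst_encode [simp]: "pfst (prod_encode (a, b)) = a"
  and psnd_encode [simp]: "psnd (prod_encode (a, b)) = b"
  and prod_encode_pfst_psnd [simp]: "prod_encode (pfst z, psnd z) = z"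
  by (simp_all add: pfst_def psnd_def)

lemma prod_decode_eq_pfst_psnd: "prod_decode z = (pfst z, psnd z)"
  by (simp add: pfst_def psnd_def)

lemma recf_triangle:
  assumes "recf n A"
  shows "recf n (\<lambda>e. triangle (A e))"
proof -
  have "triangle x = rec_nat 0 (\<lambda>k y. y + Suc k) x" for x by (induction x) auto
  then show ?thesis
    using assms by (simp only:) (intro recf_rec_nat recf_const recf_add recf_Suc recf_proj; simp)
qed

lemma recf_prod_encode: "recf n A \<Longrightarrow> recf n B \<Longrightarrow> recf n (\<lambda>e. prod_encode (A e, B e))"
  by (simp add: prod_encode_def recf_add recf_triangle)

text \<open>The sum of the two components of \<open>z\<close> is the index of the diagonal containing \<open>z\<close>.\<close>

lemma Least_diagonal: "(LEAST k. z < triangle (Suc k)) = pfst z + psnd z"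
proof (rule Least_equality)
  have z: "z = triangle (pfst z + psnd z) + pfst z"
    using prod_encode_pfst_psnd[of z] by (simp add: prod_encode_def del: prod_encode_pfst_psnd)
  then show "z < triangle (Suc (pfst z + psnd z))" by simp
  fix k assume k: "z < triangle (Suc k)"
  show "pfst z + psnd z \<le> k"
  proof (rule ccontr)
    assume "\<not> pfst z + psnd z \<le> k"
    then have "Suc k \<le> pfst z + psnd z" by simp
    moreover have "mono triangle" by (intro mono_iff_le_Suc[THEN iffD2]) simp
    ultimately have "triangle (Suc k) \<le> triangle (pfst z + psnd z)" by (rule monoD[rotated])
    with z k show False by linarith
  qed
qed

lemma computable1_diagonal: "computable1 (\<lambda>z. pfst z + psnd z)"
  unfolding computable1_iff_recf Least_diagonal[symmetric]
proof (rule recf_Least)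
  show "decf (Suc (Suc 0)) (\<lambda>e. \<not> e (Suc 0) < triangle (Suc (e 0)))"
    by (intro decf_not decf_less recf_triangle recf_Suc recf_proj) auto
  show "\<exists>k. e 0 < triangle (Suc k)" for e :: "nat \<Rightarrow> nat"
    by (rule exI[of _ "e 0"]) simp
qed

lemma recf_pfst:
  assumes "recf n A"
  shows "recf n (\<lambda>e. pfst (A e))"
proof -
  have "z - triangle (pfst z + psnd z) = pfst z" for z
    using prod_encode_pfst_psnd[of z] by (simp add: prod_encode_def del: prod_encode_pfst_psnd)
  then show ?thesis
    using recf_diff[OF assms recf_triangle[OF recf_comp1[OF computable1_diagonal assms]]] by simp
qed

lemma recf_psnd:
  assumes "recf n A"
  shows "recf n (\<lambda>e. psnd (A e))"
  using recf_diff[OF recf_comp1[OF computable1_diagonal assms] recf_pfst[OF assms]] by simp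

lemmas recf_intros = recf_const recf_proj recf_Suc recf_add recf_mult recf_diff recf_power2
  recf_min recf_if decf_if decf_le decf_less decf_not decf_conj decf_disj decf_imp decf_eq
  decf_all_less recf_rec_nat recf_prod_encode recf_pfst recf_psnd

subsection \<open>Coded sequences\<close>

text \<open>Right-nested pairs without a length or an end mark: every number codes an infinite
  sequence, so \<open>seq_nth\<close> is total.\<close>

definition seq_nth :: "nat \<Rightarrow> nat \<Rightarrow> nat" where
  "seq_nth t i = pfst ((psnd ^^ i) t)"

lemma ex_seq_code: "\<exists>t. \<forall>i\<le>k. seq_nth t i = a i"
proof (induction k arbitrary: a)
  case 0
  show ?case by (rule exI[of _ "prod_encode (a 0, 0)"]) (simp add: seq_nth_def)
next
  case (Suc k)
  obtain t where t: "\<forall>i\<le>k. seq_nth t i = a (Suc i)"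
    using Suc.IH[of "\<lambda>i. a (Suc i)"] by blast
  have "seq_nth (prod_encode (a 0, t)) i = a i" if "i \<le> Suc k" for i
    using that t by (cases i) (auto simp: seq_nth_def funpow_Suc_right simp del: funpow.simps(2))
  then show ?case by blast
qed

lemma recf_seq_nth:
  assumes "recf n A" "recf n B"
  shows "recf n (\<lambda>e. seq_nth (A e) (B e))"
proof -
  have "seq_nth t i = pfst (rec_nat t (\<lambda>_. psnd) i)" for t i
  proof -
    have "(psnd ^^ i) t = rec_nat t (\<lambda>_. psnd) i" by (induction i) auto
    then show ?thesis by (simp add: seq_nth_def)
  qed
  then show ?thesis
    using assms by (simp only:) (intro recf_rec_nat recf_pfst recf_psnd recf_proj; simp)
qed

section \<open>Distances and direct walks\<close>

definition walk_dist :: "('a \<Rightarrow> 'a \<Rightarrow> bool) \<Rightarrow> 'a \<Rightarrow> 'a \<Rightarrow> nat" where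
  "walk_dist E x y = (LEAST k. (E ^^ k) x y)"

text \<open>A substitute for being shortest that can be checked step by step: shortest walks satisfy
  it if every other vertex has an edge to \<open>c\<close>, and in a bouquet it leaves few
  lengths.\<close>

definition direct_lengths :: "('a \<Rightarrow> 'a \<Rightarrow> bool) \<Rightarrow> 'a \<Rightarrow> 'a \<Rightarrow> 'a \<Rightarrow> nat set" where
  "direct_lengths E c x y = {k. \<exists>p. p 0 = x \<and> p k = y \<and>
     (\<forall>i<k. E (p i) (p (Suc i)) \<and> p (Suc i) \<noteq> x \<and> (0 < i \<longrightarrow> p (Suc i) \<noteq> c))}"

lemma direct_lengths_walk: "k \<in> direct_lengths E c x y \<Longrightarrow> (E ^^ k) x y"
  unfolding direct_lengths_def relpowp_fun_conv by blast

lemma walk_dist_le: "(E ^^ k) x y \<Longrightarrow> walk_dist E x y \<le> k"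
  unfolding walk_dist_def by (rule Least_le)

lemma walk_dist_walk: "(E ^^ k) x y \<Longrightarrow> (E ^^ walk_dist E x y) x y"
  unfolding walk_dist_def by (rule LeastI)

lemma relpowp_path_suffix:
  assumes "\<forall>i<k. E (p i) (p (Suc i))" "j \<le> k"
  shows "(E ^^ (k - j)) (p j) (p k)"
  unfolding relpowp_fun_conv
  using assms by (intro exI[of _ "\<lambda>i. p (j + i)"]) auto

text \<open>A return to \<open>x\<close> could be cut out, and a late visit to \<open>c\<close>
  could be replaced by the edge from \<open>x\<close> to \<open>c\<close>; both would shorten a
  shortest walk.\<close>

lemma walk_dist_mem_direct_lengths:
  assumes walk: "(E ^^ k) x y" and hub: "\<And>x. x \<noteq> c \<Longrightarrow> E x c"
  shows "walk_dist E x y \<in> direct_lengths E c x y"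
proof -
  let ?d = "walk_dist E x y"
  from walk_dist_walk[OF walk] obtain p where p0: "p 0 = x" and pd: "p ?d = y"
    and p: "\<forall>i<?d. E (p i) (p (Suc i))"
    unfolding relpowp_fun_conv by blast
  have "p (Suc i) \<noteq> x" if "i < ?d" for i
  proof
    assume "p (Suc i) = x"
    with relpowp_path_suffix[where E = E and p = p, OF p, of "Suc i"] that pd have "(E ^^ (?d - Suc i)) x y" by simp
    from walk_dist_le[OF this] that show False by simp
  qed
  moreover have "p (Suc i) \<noteq> c" if "i < ?d" "0 < i" for i
  proof
    assume c: "p (Suc i) = c"
    \<comment> \<open>\<open>calculation\<close> is the fact just collected,
      \<open>p (Suc i) \<noteq> x\<close>, so \<open>c\<close> differs from
      \<open>x\<close>.\<close>
    with calculation[OF that(1)] have "E x c" using hub by auto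
    moreover have "(E ^^ (?d - Suc i)) c y"
      using relpowp_path_suffix[where E = E and p = p, OF p, of "Suc i"] that(1) pd c by simp
    ultimately have "(E ^^ Suc (?d - Suc i)) x y" by (rule relpowp_Suc_I2)
    from walk_dist_le[OF this] that show False by simp
  qed
  ultimately show ?thesis unfolding direct_lengths_def using p0 pd p by blast
qed

text \<open>Following edges along which \<open>q\<close> drops by one gives a walk of length
  \<open>q x\<close>; as no edge lowers \<open>q\<close> by more than one, no walk is
  shorter.\<close>

lemma walk_dist_eq_potential:
  fixes q :: "'a \<Rightarrow> nat"
  assumes "q y = 0" and step: "\<And>x. x \<noteq> y \<Longrightarrow> \<exists>z. E x z \<and> q x = Suc (q z)"
    and le: "\<And>x z. E x z \<Longrightarrow> q x \<le> Suc (q z)"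
  shows "(E ^^ q x) x y" "walk_dist E x y = q x"
proof -
  show w: "(E ^^ q x) x y"
  proof (induction "q x" arbitrary: x)
    case 0
    then have "x = y" using step by fastforce
    then show ?case using \<open>q y = 0\<close> by simp
  next
    case (Suc m)
    then have "x \<noteq> y" using \<open>q y = 0\<close> by auto
    then obtain z where "E x z" "q x = Suc (q z)" using step by blast
    with Suc show ?case by (metis nat.inject relpowp_Suc_I2)
  qed
  have "q x \<le> k" if "(E ^^ k) x y" for k
    using that
  proof (induction k arbitrary: x)
    case 0
    then show ?case using \<open>q y = 0\<close> by simp
  next
    case (Suc k)
    from relpowp_Suc_D2[OF Suc.prems] obtain z where "E x z" "(E ^^ k) z y" by blast
    with le[of x z] Suc.IH[of z] show ?case by simp
  qed
  with w show "walk_dist E x y = q x" unfolding walk_dist_def by (intro Least_equality) auto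
qed

section \<open>Bouquets of paths through a hub\<close>

text \<open>The hub is \<open>0\<close>. The component with index \<open>k\<close> consists of a root, at height \<open>0\<close>, and of
  one path from the hub down to the root for every \<open>a \<in> D k\<close>; that path has inner vertices at
  the heights \<open>Suc a, \<dots>, 1\<close>. If \<open>D k\<close> is empty, the hub is adjacent to the root. Every vertex
  other than the hub has an edge to the hub. For a vertex \<open>v \<noteq> 0\<close>, \<open>owner v\<close> is the index of its
  component, \<open>label v\<close> the label of its path (\<open>0\<close> for a root) and \<open>height v\<close> its height.\<close>

locale bouquet =
  fixes E :: "nat \<Rightarrow> nat \<Rightarrow> bool" and owner label height :: "nat \<Rightarrow> nat" and D :: "nat \<Rightarrow> nat set"
    and n :: nat
  assumes edge_hub: "E u 0 \<longleftrightarrow> u \<noteq> 0"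
    and hub_edge: "v \<noteq> 0 \<Longrightarrow> E 0 v \<longleftrightarrow>
      (if height v = 0 then D (owner v) = {} else height v = Suc (label v))"
    and edge: "u \<noteq> 0 \<Longrightarrow> v \<noteq> 0 \<Longrightarrow> E u v \<longleftrightarrow>
      owner u = owner v \<and> height u = Suc (height v) \<and> (height v = 0 \<or> label u = label v)"
    and inner: "v \<noteq> 0 \<Longrightarrow> 0 < height v \<Longrightarrow> label v \<in> D (owner v) \<and> height v \<le> Suc (label v)"
    and vertex_unique: "u \<noteq> 0 \<Longrightarrow> v \<noteq> 0 \<Longrightarrow> owner u = owner v \<Longrightarrow> height u = height v \<Longrightarrow>
      (height v = 0 \<or> label u = label v) \<Longrightarrow> u = v"
    and ex_root: "v \<noteq> 0 \<Longrightarrow> \<exists>u. u \<noteq> 0 \<and> owner u = owner v \<and> height u = 0"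
    and ex_inner: "v \<noteq> 0 \<Longrightarrow> a \<in> D (owner v) \<Longrightarrow> 0 < j \<Longrightarrow> j \<le> Suc a \<Longrightarrow>
      \<exists>u. u \<noteq> 0 \<and> owner u = owner v \<and> label u = a \<and> height u = j"
    and finite_D: "finite (D k)"
    and card_D: "card (D k) \<le> Suc n"
begin

text \<open>The distance from the hub. The path with label \<open>a\<close> is entered at height
  \<open>Suc a\<close>, so \<open>v\<close> is reached after \<open>1 + (Suc a - height v)\<close>
  steps; for a root the least label \<open>m\<close> is best, while an inner vertex lies on one path
  only.\<close>

definition detour :: "nat \<Rightarrow> nat \<Rightarrow> nat" where
  "detour m v = (if D (owner v) = {} then 1
     else (if height v = 0 then m else label v) + 2 - height v)"

text \<open>Here \<open>m\<close> stands for the least label in the component of \<open>v\<close>. It is a parameter because the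
  distance has to be computed from it uniformly.\<close>

definition gap :: "nat \<Rightarrow> nat \<Rightarrow> nat \<Rightarrow> nat" where
  "gap m u v = (if u = v then 0 else if v = 0 then 1 else
     if u = 0 then detour m v else
     if owner u = owner v \<and> height v < height u \<and> (height v = 0 \<or> label u = label v)
     then min (height u - height v) (Suc (detour m v)) else Suc (detour m v))"

text \<open>\<open>gap\<close> is a potential in the sense of \<open>walk_dist_eq_potential\<close>:
  \<open>down\<close> finds a neighbour one step closer to \<open>v\<close>, and \<open>up\<close>
  shows that no edge gains more.\<close>

lemma gap_dist:
  defines "m \<equiv> \<lambda>v. Min (D (owner v))"
  shows "(E ^^ gap (m v) u v) u v" "walk_dist E u v = gap (m v) u v"
proof -
  have mle: "m v \<le> a" if "a \<in> D (owner v)" for a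
    unfolding m_def using that finite_D by simp
  have mD: "m v \<in> D (owner v)" if "D (owner v) \<noteq> {}"
    unfolding m_def using that finite_D by simp
  have down: "\<exists>z. E x z \<and> gap (m v) x v = Suc (gap (m v) z v)" if "x \<noteq> v" for x
  proof (cases "v = 0")
    case True
    with that show ?thesis by (intro exI[of _ 0]) (simp add: edge_hub gap_def)
  next
    case v: False
    show ?thesis
    proof (cases "x = 0")
      case x: True
      show ?thesis
      proof (cases "D (owner v) = {}")
        case True
        then have "height v = 0" using inner[OF v] by auto
        with True v x show ?thesis
          by (intro exI[of _ v]) (simp add: hub_edge gap_def detour_def)
      next
        case ne: False
        \<comment> \<open>The label of the path by which \<open>v\<close> is approached from the
          hub; \<open>z\<close> below is the top of that path.\<close>
        define a where "a = (if height v = 0 then m v else label v)"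
        have a: "a \<in> D (owner v)" "height v \<le> Suc a"
          using mD[OF ne] inner[OF v] by (auto simp: a_def)
        obtain z where z: "z \<noteq> 0" "owner z = owner v" "label z = a" "height z = Suc a"
          using ex_inner[OF v a(1), of "Suc a"] by auto
        have "gap (m v) z v = Suc a - height v"
        proof (cases "z = v")
          case True
          with z show ?thesis by (simp add: gap_def)
        next
          case False
          then have "height v < Suc a"
            using vertex_unique[OF z(1) v z(2)] a(2) z(3,4) a_def
            by (metis le_neq_implies_less)
          with False v z ne show ?thesis by (auto simp: gap_def detour_def a_def min_def)
        qed
        moreover have "gap (m v) x v = Suc (Suc a) - height v"
          using v x ne by (simp add: gap_def detour_def a_def)
        ultimately show ?thesis using x z a
          by (intro exI[of _ z]) (auto simp: hub_edge)
      qed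
    next
      case x: False
      let ?dir = "owner x = owner v \<and> height v < height x \<and> (height v = 0 \<or> label x = label v)"
      show ?thesis
      \<comment> \<open>A root \<open>v\<close> below \<open>x\<close> may be reached faster through
        the hub if its component has a much shorter path.\<close>
      proof (cases "?dir \<and> height x - height v \<le> Suc (detour (m v) v)")
        case True
        then have dir: ?dir by blast
        have lx: "label x \<in> D (owner v)" "height x \<le> Suc (label x)"
          using inner[OF x] dir by auto
        obtain z where z: "z \<noteq> 0" "owner z = owner v" "height z = height x - 1"
          "height z = 0 \<or> label z = label x"
        proof (cases "height x = 1")
          case True
          then show ?thesis using ex_root[OF v] that by force
        next
          case False
          with dir have "0 < height x - 1" "height x - 1 \<le> Suc (label x)" using lx by auto
          from ex_inner[OF v lx(1) this] that show ?thesis by blast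
        qed
        have e: "E x z" using x z dir by (auto simp: edge)
        have "gap (m v) z v = height x - 1 - height v"
        proof (cases "height v = height z")
          case True
          then have "z = v" using vertex_unique[OF z(1) v] z dir by auto
          with z show ?thesis by (simp add: gap_def)
        next
          case False
          with z dir have "height v < height z" by auto
          with z dir v True show ?thesis by (auto simp: gap_def)
        qed
        with True that v x dir show ?thesis
          by (intro exI[of _ z]) (auto simp: gap_def e)
      next
        case False
        then have "gap (m v) x v = Suc (detour (m v) v)" using that v x by (auto simp: gap_def)
        with v x show ?thesis by (intro exI[of _ 0]) (simp add: edge_hub gap_def)
      qed
    qed
  qed
  have up: "gap (m v) x v \<le> Suc (gap (m v) z v)" if e: "E x z" for x z
  proof (cases "v = 0 \<or> x = v \<or> z = 0")
    case True
    then show ?thesis using e by (auto simp: gap_def edge_hub split: if_splits)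
  next
    case False
    then have nz: "v \<noteq> 0" "x \<noteq> v" "z \<noteq> 0" by auto
    show ?thesis
    proof (cases "x = 0")
      case True
      have h: "if height z = 0 then D (owner z) = {} else height z = Suc (label z)"
        using e True hub_edge[OF nz(3)] by simp
      show ?thesis
      proof (cases "height z = 0")
        case z0: True
        then show ?thesis using h nz True by (auto simp: gap_def detour_def)
      next
        case False
        then have "label z \<in> D (owner z)" "height z = Suc (label z)" using inner[OF nz(3)] h by auto
        with nz True mle[of "label z"] show ?thesis
          by (auto simp: gap_def detour_def)
      qed
    next
      case x: False
      from e have "owner x = owner z" "height x = Suc (height z)"
        "height z = 0 \<or> label x = label z" using edge[OF x nz(3)] by auto
      with nz x show ?thesis by (auto simp: gap_def)
    qed
  qed
  have "gap (m v) v v = 0" by (simp add: gap_def)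
  from walk_dist_eq_potential[where q = "\<lambda>u. gap (m v) u v", OF this down up]
  show "(E ^^ gap (m v) u v) u v" "walk_dist E u v = gap (m v) u v" by blast+
qed

text \<open>Away from the hub every edge goes one step down in the same component, and the label can
  change only on reaching the root.\<close>

lemma hub_free_walk:
  assumes "\<forall>i<k. E (p i) (p (Suc i))" "\<forall>i. a \<le> i \<and> i \<le> k \<longrightarrow> p i \<noteq> 0" "a \<le> i" "i \<le> k"
  shows "owner (p i) = owner (p a) \<and> height (p i) + (i - a) = height (p a) \<and>
    (height (p i) = 0 \<or> label (p i) = label (p a))"
  using assms(3,4)
proof (induction i rule: dec_induct)
  case (step i)
  have "p i \<noteq> 0" "p (Suc i) \<noteq> 0" using assms(2) step by auto
  moreover have "E (p i) (p (Suc i))" using assms(1) step by auto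
  ultimately show ?case using edge step by auto
qed auto

text \<open>The possible lengths of a direct walk from \<open>u\<close> to \<open>v\<close> whose last part runs along the path
  with label \<open>a\<close>. A walk to \<open>v\<close> through the hub along the path containing \<open>u\<close> above \<open>v\<close>
  would return to \<open>u\<close>, which is why each label contributes only one length.\<close>

definition route :: "nat \<Rightarrow> nat \<Rightarrow> nat \<Rightarrow> nat" where
  "route u v a = (if u \<noteq> 0 \<and> owner u = owner v \<and> height v < height u \<and> label u = a
     then height u - height v else of_bool (u \<noteq> 0) + a + 2 - height v)"

text \<open>A direct walk avoiding the hub descends straight from \<open>u\<close> to
  \<open>v\<close>. Otherwise it is at the hub once, at position 0 or 1, and then enters a bare root
  or descends along one path, whose label determines the length.\<close>

lemma direct_lengths_subset_route:
  assumes v: "v \<noteq> 0" and uv: "u \<noteq> v"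
  shows "direct_lengths E 0 u v \<subseteq> (if D (owner v) = {} then {Suc (of_bool (u \<noteq> 0))}
    else route u v ` (if height v = 0 then D (owner v) else {label v}))"
proof
  fix k assume "k \<in> direct_lengths E 0 u v"
  then obtain p where p0: "p 0 = u" and pk: "p k = v"
    and p: "\<forall>i<k. E (p i) (p (Suc i)) \<and> p (Suc i) \<noteq> u \<and> (0 < i \<longrightarrow> p (Suc i) \<noteq> 0)"
    unfolding direct_lengths_def by blast
  have E: "\<forall>i<k. E (p i) (p (Suc i))" using p by blast
  have k: "0 < k" using p0 pk uv by (cases k) auto
  have nz: "p i \<noteq> 0" if "1 < i" "i \<le> k" for i using p that by (cases i) auto
  show "k \<in> (if D (owner v) = {} then {Suc (of_bool (u \<noteq> 0))}
    else route u v ` (if height v = 0 then D (owner v) else {label v}))"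
  proof (cases "u \<noteq> 0 \<and> p 1 \<noteq> 0")
    case True
    have "p i \<noteq> 0" if "i \<le> k" for i
      using nz[OF _ that] True p0 by (cases "i = 0"; cases "i = 1") auto
    from hub_free_walk[OF E, of 0 k] this p0 pk
    have w: "owner v = owner u" "height v + k = height u" "height v = 0 \<or> label v = label u" by auto
    then have "label u \<in> D (owner v)" using inner[of u] True k by auto
    moreover have "k = route u v (label u)" using w True k by (auto simp: route_def)
    ultimately show ?thesis using w(3) by auto
  next
    case False
    \<comment> \<open>The position of the hub in the walk.\<close>
    define a where "a = (of_bool (u \<noteq> 0) :: nat)"
    have pa: "p a = 0" using False p0 by (auto simp: a_def)
    have ak: "a < k" using k pa pk v by (cases "a = k") (auto simp: a_def)
    \<comment> \<open>For \<open>u = 0\<close>, the hub at position 1 is excluded because the walk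
      does not return to \<open>u\<close>.\<close>
    have nz': "p i \<noteq> 0" if "Suc a \<le> i" "i \<le> k" for i
    proof (cases "1 < i")
      case False
      with that have "a = 0" "i = 1" by auto
      with that p p0 show ?thesis by (auto simp: a_def)
    qed (use nz that in simp)
    note w = hub_free_walk[OF E, of "Suc a"]
    have wk: "owner v = owner (p (Suc a))" "height v + (k - Suc a) = height (p (Suc a))"
      "height v = 0 \<or> label v = label (p (Suc a))"
      using w[of k] nz' ak pk by auto
    have top: "p (Suc a) \<noteq> 0" "if height (p (Suc a)) = 0 then D (owner v) = {}
      else height (p (Suc a)) = Suc (label (p (Suc a)))"
      using nz'[of "Suc a"] ak E pa hub_edge[of "p (Suc a)"] wk(1) by auto
    show ?thesis
    proof (cases "D (owner v) = {}")
      case True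
      then have "height (p (Suc a)) = 0" using inner[OF top(1)] wk(1) by auto
      with wk ak have "k = Suc a" by auto
      with True show ?thesis by (simp add: a_def)
    next
      case False
      define b where "b = label (p (Suc a))"
      have hb: "height (p (Suc a)) = Suc b" using top(2) False by (auto simp: b_def split: if_splits)
      have bD: "b \<in> D (owner v)" using inner[OF top(1)] hb wk(1) by (auto simp: b_def)
      have "\<not> (u \<noteq> 0 \<and> owner u = owner v \<and> height v < height u \<and> label u = b)"
      proof
        assume u: "u \<noteq> 0 \<and> owner u = owner v \<and> height v < height u \<and> label u = b"
        then have "height u \<le> Suc b" using inner[of u] by auto
        \<comment> \<open>The position at which the descent from the hub reaches the height of
          \<open>u\<close>; by uniqueness of vertices the walk is at \<open>u\<close> again
          there.\<close>
        define i where "i = Suc a + (Suc b - height u)"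
        have i: "Suc a \<le> i" "i \<le> k" using u wk(2) hb ak by (auto simp: i_def)
        have "owner (p i) = owner u" "height (p i) = height u" "height u = 0 \<or> label (p i) = label u"
          using w[OF _ i] nz' wk(1) hb u \<open>height u \<le> Suc b\<close> by (auto simp: i_def b_def)
        then have "p i = u" using vertex_unique[of "p i" u] nz'[OF i] u by auto
        moreover have "p i \<noteq> u" using p i by (cases i) auto
        ultimately show False by blast
      qed
      then have "k = route u v b" using wk(2) hb ak by (auto simp: route_def a_def)
      with bD False wk(3) show ?thesis by (auto simp: b_def)
    qed
  qed
qed

text \<open>For \<open>u \<noteq> v\<close> and \<open>v \<noteq> 0\<close> each label contributes
  one length. A direct walk from a vertex to itself has length 0, one from another vertex to the hub
  has length 1.\<close>

lemma direct_lengths_finite_card: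
  "finite (direct_lengths E 0 u v) \<and> card (direct_lengths E 0 u v) \<le> Suc n"
proof -
  have "\<exists>S. direct_lengths E 0 u v \<subseteq> S \<and> finite S \<and> card S \<le> Suc n"
  proof -
    consider "u = v" | "u \<noteq> v" "v = 0" | "u \<noteq> v" "v \<noteq> 0" by blast
    then show ?thesis
    proof cases
      case 1
      have "k = 0" if "k \<in> direct_lengths E 0 u v" for k
        using that 1 unfolding direct_lengths_def by (cases k) auto
      then show ?thesis by (intro exI[of _ "{0}"]) auto
    next
      case 2
      have "k = 1" if "k \<in> direct_lengths E 0 u v" for k
      proof -
        from that 2 obtain p where "p 0 = u" "p k = 0"
          and "\<forall>i<k. 0 < i \<longrightarrow> p (Suc i) \<noteq> 0" unfolding direct_lengths_def by blast
        then show "k = 1" using 2 by (cases k; cases "k - 1") auto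
      qed
      then show ?thesis by (intro exI[of _ "{1}"]) auto
    next
      case 3
      let ?P = "if height v = 0 then D (owner v) else {label v}"
      have "finite ?P" "card ?P \<le> Suc n" using finite_D card_D by auto
      then have "finite (route u v ` ?P)" "card (route u v ` ?P) \<le> Suc n"
        using card_image_le[of ?P "route u v"] by auto
      then show ?thesis using direct_lengths_subset_route[OF 3(2,1)]
        by (intro exI conjI) (assumption, auto)
    qed
  qed
  then show ?thesis by (meson card_mono finite_subset le_trans)
qed

end

section \<open>Approximating distances from above\<close>

text \<open>Each change leads to a value not taken before, so the changes inject into
  \<open>S - {f 0}\<close>; removing \<open>f 0\<close> turns \<open>Suc n\<close> values into
  \<open>n\<close> changes.\<close>

lemma card_changes_antimono:
  fixes f :: "nat \<Rightarrow> nat"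
  assumes mono: "\<And>s. f (Suc s) \<le> f s" and S: "range f \<subseteq> S" "finite S" "card S \<le> Suc n"
  shows "finite {s. f s \<noteq> f (Suc s)}" "card {s. f s \<noteq> f (Suc s)} \<le> n"
proof -
  let ?C = "{s. f s \<noteq> f (Suc s)}"
  have le: "f t \<le> f s" if "s \<le> t" for s t
    using that by (rule lift_Suc_antimono_le[of f, OF mono])
  have less: "f (Suc s) < f s" if "s \<in> ?C" for s using that mono[of s] by simp
  have neq: "f (Suc s) \<noteq> f (Suc t)" if "s < t" "t \<in> ?C" for s t
    using less[OF that(2)] le[of "Suc s" t] that(1) by linarith
  have inj: "inj_on (\<lambda>s. f (Suc s)) ?C"
  proof (rule inj_onI)
    fix s t assume st: "s \<in> ?C" "t \<in> ?C" "f (Suc s) = f (Suc t)"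
    show "s = t"
    proof (rule linorder_cases)
      assume "s < t"
      from neq[OF this st(2)] st(3) show ?thesis by contradiction
    next
      assume "t < s"
      from neq[OF this st(1)] st(3)[symmetric] show ?thesis by contradiction
    qed
  qed
  have sub: "(\<lambda>s. f (Suc s)) ` ?C \<subseteq> S - {f 0}"
  proof (rule image_subsetI)
    fix s assume "s \<in> ?C"
    from less[OF this] le[of 0 s] have "f (Suc s) \<noteq> f 0" by linarith
    then show "f (Suc s) \<in> S - {f 0}" using S(1) by blast
  qed
  have fin: "finite (S - {f 0})" using S(2) by simp
  show "finite ?C" using inj_on_finite[OF inj sub fin] .
  have "card ?C \<le> card (S - {f 0})" using card_inj_on_le[OF inj sub fin] .
  also have "\<dots> \<le> n"
    using S(3) card_Diff_singleton[OF subsetD[OF S(1) rangeI[of f 0]]] by simp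
  finally show "card ?C \<le> n" .
qed

text \<open>The converse count: \<open>n\<close> changes allow at most \<open>Suc n\<close>
  values.\<close>

lemma range_subset_changes: "range f \<subseteq> insert (f 0) ((\<lambda>s. f (Suc s)) ` {s. f s \<noteq> f (Suc s)})"
proof
  fix y assume "y \<in> range f"
  then obtain t where "y = f t" by blast
  moreover have "f t \<in> insert (f 0) ((\<lambda>s. f (Suc s)) ` {s. f s \<noteq> f (Suc s)})"
  proof (induction t)
    case (Suc t)
    show ?case
    proof (cases "f t = f (Suc t)")
      case True
      with Suc show ?thesis by metis
    next
      case False
      then show ?thesis by (intro insertI2 image_eqI[of _ _ t]) simp_all
    qed
  qed simp
  ultimately show "y \<in> insert (f 0) ((\<lambda>s. f (Suc s)) ` {s. f s \<noteq> f (Suc s)})" by simp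
qed

text \<open>Here \<open>z\<close> codes the pair of endpoints, and \<open>t\<close> the pair of a
  length and a code of the vertex sequence.\<close>

definition codes_direct_walk :: "(nat \<Rightarrow> nat \<Rightarrow> bool) \<Rightarrow> nat \<Rightarrow> nat \<Rightarrow> nat \<Rightarrow> bool" where
  "codes_direct_walk E c z t \<longleftrightarrow>
     seq_nth (psnd t) 0 = pfst z \<and> seq_nth (psnd t) (pfst t) = psnd z \<and>
     (\<forall>i<pfst t. E (seq_nth (psnd t) i) (seq_nth (psnd t) (Suc i)) \<and>
        seq_nth (psnd t) (Suc i) \<noteq> pfst z \<and> (0 < i \<longrightarrow> seq_nth (psnd t) (Suc i) \<noteq> c))"

lemma direct_lengths_iff_code:
  "k \<in> direct_lengths E c (pfst z) (psnd z) \<longleftrightarrow> (\<exists>t. codes_direct_walk E c z t \<and> pfst t = k)"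
proof
  assume "k \<in> direct_lengths E c (pfst z) (psnd z)"
  then obtain p where p: "p 0 = pfst z" "p k = psnd z"
    "\<forall>i<k. E (p i) (p (Suc i)) \<and> p (Suc i) \<noteq> pfst z \<and> (0 < i \<longrightarrow> p (Suc i) \<noteq> c)"
    unfolding direct_lengths_def by blast
  obtain t where "\<forall>i\<le>k. seq_nth t i = p i" using ex_seq_code by blast
  with p have "codes_direct_walk E c z (prod_encode (k, t))"
    by (auto simp: codes_direct_walk_def)
  then show "\<exists>t. codes_direct_walk E c z t \<and> pfst t = k" by (metis pfst_encode)
qed (auto simp: codes_direct_walk_def direct_lengths_def)

lemma decf_codes_direct_walk:
  assumes E: "computable2 (\<lambda>x y. of_bool (E x y))" and A: "recf n A" and B: "recf n B"
  shows "decf n (\<lambda>e. codes_direct_walk E c (A e) (B e))"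
proof -
  have "computable2 (\<lambda>x y. of_bool (codes_direct_walk E c x y))"
    unfolding computable2_iff_recf codes_direct_walk_def
    by (intro recf_intros recf_seq_nth recf_comp2[OF E]) auto
  from recf_comp2[OF this A B] show ?thesis .
qed

text \<open>The approximation is the least length among the valid codes inspected so far. All its
  values are direct lengths, so it changes at most \<open>n\<close> times, and the distance is
  eventually found.\<close>

lemma approx_walk_dist:
  fixes E :: "nat \<Rightarrow> nat \<Rightarrow> bool"
  assumes E: "computable2 (\<lambda>x y. of_bool (E x y))"
    and hub: "\<And>x. x \<noteq> c \<Longrightarrow> E x c"
    and conn: "\<And>x y. \<exists>k. (E ^^ k) x y"
    and card: "\<And>x y. finite (direct_lengths E c x y) \<and> card (direct_lengths E c x y) \<le> Suc n"
  shows "approx_from_above n (\<lambda>z. walk_dist E (pfst z) (psnd z))"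
proof -
  let ?V = "codes_direct_walk E c"
  let ?L = "\<lambda>z. direct_lengths E c (pfst z) (psnd z)"
  let ?d = "\<lambda>z. walk_dist E (pfst z) (psnd z)"
  \<comment> \<open>Starting the stages at the first valid code makes the value at stage 0 a direct
    length; a dummy start could cost one more change.\<close>
  define first where "first z = (LEAST t. ?V z t)" for z
  define g where "g z s = rec_nat (pfst (first z))
    (\<lambda>i y. if ?V z (first z + Suc i) then min y (pfst (first z + Suc i)) else y) s" for z s
  have dL: "?d z \<in> ?L z" for z
    using conn[of "pfst z" "psnd z"] walk_dist_mem_direct_lengths[where E = E and c = c, OF _ hub]
    by blast
  have ex: "\<exists>t. ?V z t" for z
    using dL[of z] unfolding direct_lengths_iff_code by blast
  have first: "computable1 first"
    unfolding computable1_iff_recf first_def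
    by (rule recf_Least[where P = "\<lambda>k e. ?V (e 0) k"])
      (intro recf_intros decf_codes_direct_walk[OF E] ex; simp)+
  have g: "computable2 g"
    unfolding computable2_iff_recf g_def
    by (intro recf_intros decf_codes_direct_walk[OF E] recf_comp1[OF first]) auto
  have anti: "g z (Suc s) \<le> g z s" for z s by (simp add: g_def)
  have inL: "g z s \<in> ?L z" for z s
  proof (induction s)
    case 0
    have "?V z (first z)" unfolding first_def using ex by (rule LeastI_ex)
    then show ?case unfolding direct_lengths_iff_code by (auto simp: g_def)
  next
    case (Suc s)
    show ?case
    proof (cases "?V z (first z + Suc s)")
      case True
      then have "pfst (first z + Suc s) \<in> ?L z" unfolding direct_lengths_iff_code by blast
      with Suc show ?thesis by (simp add: g_def min_def)
    qed (use Suc in \<open>simp add: g_def\<close>)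
  qed
  have le_code: "g z s \<le> pfst t" if "?V z t" "t \<le> first z + s" for z s t
    using that(2)
  proof (induction s)
    case 0
    moreover have "first z \<le> t" unfolding first_def using that(1) by (rule Least_le)
    ultimately show ?case by (simp add: g_def)
  next
    case (Suc s)
    then show ?case using that(1) anti[of z s]
      by (cases "t = first z + Suc s") (auto simp: g_def)
  qed
  have lim: "g z \<longlonglongrightarrow> ?d z" for z
  proof -
    obtain t where t: "?V z t" "pfst t = ?d z"
      using dL[of z] unfolding direct_lengths_iff_code by blast
    have "g z s = ?d z" if "t \<le> s" for s
    proof (rule antisym)
      show "g z s \<le> ?d z" using le_code[OF t(1), of s] t(2) that by simp
      show "?d z \<le> g z s" by (rule walk_dist_le[OF direct_lengths_walk[OF inL]])
    qed
    then show ?thesis by (intro tendsto_eventually) (auto simp: eventually_sequentially)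
  qed
  have "range (g z) \<subseteq> ?L z" for z using inL by blast
  note ch = card_changes_antimono[OF anti this conjunct1[OF card] conjunct2[OF card]]
  show ?thesis unfolding approx_from_above_def using g lim anti ch by blast
qed

section \<open>Digraphs and walks\<close>

abbreviation arc :: "nat pair_pre_digraph \<Rightarrow> nat \<Rightarrow> nat \<Rightarrow> bool" where
  "arc G x y \<equiv> (x, y) \<in> parcs G"

lemma vwalk_arcs_conv_nth: "set (vwalk_arcs p) = {(p ! i, p ! Suc i) | i. Suc i < length p}"
proof (induction p rule: vwalk_arcs.induct)
  case (3 x y xs)
  have "{((x # y # xs) ! i, (x # y # xs) ! Suc i) | i. Suc i < length (x # y # xs)} =
    insert (x, y) {((y # xs) ! i, (y # xs) ! Suc i) | i. Suc i < length (y # xs)}"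
    (is "?A = ?B")
  proof
    show "?A \<subseteq> ?B"
    proof
      fix a assume "a \<in> ?A"
      then obtain i where "a = ((x # y # xs) ! i, (x # y # xs) ! Suc i)" "Suc i < length (x # y # xs)"
        by blast
      then show "a \<in> ?B" by (cases i) auto
    qed
    show "?B \<subseteq> ?A" by force
  qed
  with 3 show ?case by simp
qed auto

lemma vwalk_iff_relpowp:
  assumes "pverts G = UNIV"
  shows "(\<exists>p. vwalk p (with_proj G) \<and> hd p = x \<and> last p = y \<and> vwalk_length p = k) \<longleftrightarrow>
    (arc G ^^ k) x y"
proof
  assume "\<exists>p. vwalk p (with_proj G) \<and> hd p = x \<and> last p = y \<and> vwalk_length p = k"
  then obtain p where p: "vwalk p (with_proj G)" "hd p = x" "last p = y" "length p - 1 = k" by auto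
  then have "p \<noteq> []" "\<forall>i. Suc i < length p \<longrightarrow> arc G (p ! i) (p ! Suc i)"
    by (auto simp: vwalk_def vwalk_arcs_conv_nth)
  with p show "(arc G ^^ k) x y"
    unfolding relpowp_fun_conv
    by (intro exI[of _ "\<lambda>i. p ! i"]) (auto simp: hd_conv_nth last_conv_nth)
next
  assume "(arc G ^^ k) x y"
  then obtain q where q: "q 0 = x" "q k = y" "\<forall>i<k. arc G (q i) (q (Suc i))"
    unfolding relpowp_fun_conv by blast
  let ?p = "map q [0..<Suc k]"
  have "vwalk ?p (with_proj G)"
    using q(3) assms by (auto simp: vwalk_def vwalk_arcs_conv_nth simp del: upt_Suc)
  moreover have "hd ?p = x" "last ?p = y" "vwalk_length ?p = k"
    using q by (simp_all add: hd_map last_map del: upt_Suc)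
  ultimately show "\<exists>p. vwalk p (with_proj G) \<and> hd p = x \<and> last p = y \<and> vwalk_length p = k"
    by blast
qed

lemma distance_function_eq_walk_dist:
  "pverts G = UNIV \<Longrightarrow> distance_function G = (\<lambda>z. walk_dist (arc G) (pfst z) (psnd z))"
  unfolding distance_function_def directed_distance_def walk_dist_def
  by (simp add: vwalk_iff_relpowp prod_decode_eq_pfst_psnd del: vwalk_length_simp)

text \<open>Equality with \<open>with_proj H\<close> forces the end maps of the isomorphism to be
  \<open>fst\<close> and \<open>snd\<close>, so its arc map is the vertex map on both coordinates.
  As \<open>H\<close> is infinite, its domain is not a finite initial segment.\<close>

lemma isomorphic_iff:
  assumes G: "pverts G = UNIV" and H: "computable_digraph H"
  shows "isomorphic G H \<longleftrightarrow>
    pverts H = UNIV \<and> (\<exists>f. bij f \<and> (\<forall>x y. arc H (f x) (f y) \<longleftrightarrow> arc G x y))"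
proof
  assume "isomorphic G H"
  then obtain m where m: "pre_digraph.digraph_isomorphism (with_proj G) m"
    and app: "with_proj H = app_iso m (with_proj G)"
    unfolding isomorphic_def digraph_iso_def by blast
  let ?f = "iso_verts m"
  have inj: "inj ?f"
    and ends: "\<And>a. a \<in> parcs G \<Longrightarrow> ?f (fst a) = iso_tail m (iso_arcs m a) \<and>
      ?f (snd a) = iso_head m (iso_arcs m a)"
    using m G by (auto simp: pre_digraph.digraph_isomorphism_def)
  have pv: "pverts H = range ?f" and pa: "parcs H = iso_arcs m ` parcs G"
    and tl: "iso_tail m = fst" and hd: "iso_head m = snd"
    using app G by (auto simp: with_proj_def app_iso_def)
  have "iso_arcs m (x, y) = (?f x, ?f y)" if "arc G x y" for x y
    using ends[OF that] tl hd by (simp add: prod_eq_iff)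
  then have "parcs H = (\<lambda>(x, y). (?f x, ?f y)) ` parcs G"
    unfolding pa by (intro image_cong) auto
  then have arcs: "arc H (?f x) (?f y) \<longleftrightarrow> arc G x y" for x y
    using inj by (auto simp: inj_eq)
  have "infinite (pverts H)" using inj pv by (simp add: finite_image_iff)
  with H have UNIV: "pverts H = UNIV"
    unfolding computable_digraph_def by (metis finite_lessThan)
  with pv inj have "bij ?f" by (simp add: bij_def)
  with UNIV arcs show "pverts H = UNIV \<and> (\<exists>f. bij f \<and> (\<forall>x y. arc H (f x) (f y) \<longleftrightarrow> arc G x y))"
    by blast
next
  assume "pverts H = UNIV \<and> (\<exists>f. bij f \<and> (\<forall>x y. arc H (f x) (f y) \<longleftrightarrow> arc G x y))"
  then obtain f where UNIV: "pverts H = UNIV" and f: "bij f"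
    and arcs: "\<And>x y. arc H (f x) (f y) \<longleftrightarrow> arc G x y" by blast
  define m where "m = \<lparr>iso_verts = f, iso_arcs = map_prod f f, iso_head = snd, iso_tail = fst\<rparr>"
  have "inj f" using f by (simp add: bij_def)
  moreover have "inj_on (map_prod f f) (parcs G)"
    by (rule inj_on_subset[OF prod.inj_map[OF \<open>inj f\<close> \<open>inj f\<close>] subset_UNIV])
  ultimately have "pre_digraph.digraph_isomorphism (with_proj G) m"
    using G by (simp add: pre_digraph.digraph_isomorphism_def m_def wf_digraph_def)
  moreover have "with_proj H = app_iso m (with_proj G)"
  proof -
    have "parcs H = map_prod f f ` parcs G"
    proof
      show "parcs H \<subseteq> map_prod f f ` parcs G"
      proof
        fix a assume a: "a \<in> parcs H"
        obtain x y where "fst a = f x" "snd a = f y" using f by (metis bij_pointE)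
        then have xy: "a = map_prod f f (x, y)" by (simp add: prod_eq_iff)
        with a have "arc H (f x) (f y)" by simp
        then have "(x, y) \<in> parcs G" by (simp add: arcs)
        with xy show "a \<in> map_prod f f ` parcs G" by (rule image_eqI)
      qed
    qed (use arcs in auto)
    with G UNIV f show ?thesis by (simp add: with_proj_def app_iso_def m_def bij_def)
  qed
  ultimately show "isomorphic G H" unfolding isomorphic_def digraph_iso_def by blast
qed

lemma direct_lengths_iso_subset:
  assumes "\<And>x y. E' (f x) (f y) \<Longrightarrow> E x y" and "bij f"
  shows "direct_lengths E' (f c) (f x) (f y) \<subseteq> direct_lengths E c x y"
proof
  fix k assume "k \<in> direct_lengths E' (f c) (f x) (f y)"
  then obtain p where p: "p 0 = f x" "p k = f y" "\<forall>i<k. E' (p i) (p (Suc i)) \<and>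
      p (Suc i) \<noteq> f x \<and> (0 < i \<longrightarrow> p (Suc i) \<noteq> f c)"
    unfolding direct_lengths_def by blast
  let ?q = "\<lambda>i. inv f (p i)"
  have fq: "f (?q i) = p i" for i using assms(2) by (simp add: bij_is_surj surj_f_inv_f)
  have inv_f: "inv f (f a) = a" for a using assms(2) by (simp add: bij_is_inj)
  have "?q 0 = x" "?q k = y" using p inv_f by simp_all
  moreover have "E (?q i) (?q (Suc i)) \<and> ?q (Suc i) \<noteq> x \<and> (0 < i \<longrightarrow> ?q (Suc i) \<noteq> c)" if "i < k" for i
    using p(3) that assms(1)[of "?q i" "?q (Suc i)"] fq by metis
  ultimately show "k \<in> direct_lengths E c x y"
    unfolding direct_lengths_def by (intro CollectI exI[of _ ?q]) blast
qed

text \<open>The isomorphism \<open>f\<close> is arbitrary: the algorithm uses only the constant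
  \<open>f 0\<close>, the hub of \<open>H\<close>, while connectedness and the bound on the number
  of lengths transfer along \<open>f\<close>.\<close>

lemma (in bouquet) intrinsically_approx:
  assumes G: "pverts G = UNIV" "arc G = E"
  shows "intrinsically_approx_from_above n G"
  unfolding intrinsically_approx_from_above_def
proof (intro allI impI)
  fix H assume H: "computable_digraph H \<and> isomorphic G H"
  then obtain f where UNIV: "pverts H = UNIV" and f: "bij f"
    and arcs: "\<And>x y. arc H (f x) (f y) \<longleftrightarrow> E x y"
    using isomorphic_iff[OF G(1)] G(2) by meson
  have surj: "\<exists>a. x = f a" for x using f by (metis bij_pointE)
  show "approx_from_above n (distance_function H)"
    unfolding distance_function_eq_walk_dist[OF UNIV]
  proof (rule approx_walk_dist)
    show "computable2 (\<lambda>x y. of_bool (arc H x y))" using H by (simp add: computable_digraph_def)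
    show "arc H x (f 0)" if "x \<noteq> f 0" for x
      using surj[of x] that arcs edge_hub by auto
    show "\<exists>k. (arc H ^^ k) x y" for x y
    proof -
      obtain a b where ab: "x = f a" "y = f b" using surj by metis
      obtain p k where "p 0 = a" "p k = b" "\<forall>i<k. E (p i) (p (Suc i))"
        using gap_dist(1)[of b a] unfolding relpowp_fun_conv by blast
      then have "(arc H ^^ k) x y"
        unfolding relpowp_fun_conv ab by (intro exI[of _ "\<lambda>i. f (p i)"]) (simp add: arcs)
      then show ?thesis by blast
    qed
    show "finite (direct_lengths (arc H) (f 0) x y) \<and>
        card (direct_lengths (arc H) (f 0) x y) \<le> Suc n" for x y
    proof -
      obtain a b where ab: "x = f a" "y = f b" using surj by metis
      have "direct_lengths (arc H) (f 0) x y \<subseteq> direct_lengths E 0 a b"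
        unfolding ab using arcs f by (intro direct_lengths_iso_subset) auto
      with direct_lengths_finite_card[of a b] show ?thesis
        by (meson card_mono finite_subset le_trans)
    qed
  qed
qed

section \<open>Isomorphism of bouquets\<close>

text \<open>For each type the two sets of indices are infinite sets of numbers, matched through
  their enumerations; these matchings are glued.\<close>

lemma ex_bij_betw_same_type:
  fixes K K' :: "nat set"
  assumes K: "\<And>k. k \<in> K \<Longrightarrow> D k \<in> T" and K': "\<And>k. k \<in> K' \<Longrightarrow> D' k \<in> T"
    and inf: "\<And>S. S \<in> T \<Longrightarrow> infinite {k \<in> K. D k = S}"
    and inf': "\<And>S. S \<in> T \<Longrightarrow> infinite {k \<in> K'. D' k = S}"
  shows "\<exists>\<pi>. bij_betw \<pi> K K' \<and> (\<forall>k\<in>K. D' (\<pi> k) = D k)"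
proof -
  have "\<exists>b. bij_betw b {k \<in> K. D k = S} {k \<in> K'. D' k = S}" if "S \<in> T" for S
    using bij_betw_trans[OF bij_betw_inv_into[OF bij_enumerate[OF inf[OF that]]]
        bij_enumerate[OF inf'[OF that]]] by blast
  then obtain b where b: "\<And>S. S \<in> T \<Longrightarrow> bij_betw (b S) {k \<in> K. D k = S} {k \<in> K'. D' k = S}"
    by metis
  define \<pi> where "\<pi> k = b (D k) k" for k
  have \<pi>: "\<pi> k \<in> K' \<and> D' (\<pi> k) = D k" if "k \<in> K" for k
    using bij_betwE[OF b[OF K[OF that]]] that unfolding \<pi>_def by blast
  have "inj_on \<pi> K"
  proof (rule inj_onI)
    fix k l assume kl: "k \<in> K" "l \<in> K" "\<pi> k = \<pi> l"
    then have "D k = D l" using \<pi> by metis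
    with kl bij_betw_imp_inj_on[OF b[OF K[OF kl(1)]]] show "k = l"
      unfolding \<pi>_def inj_on_def by auto
  qed
  moreover have "k' \<in> \<pi> ` K" if "k' \<in> K'" for k'
  proof -
    have "k' \<in> b (D' k') ` {k \<in> K. D k = D' k'}"
      using bij_betw_imp_surj_on[OF b[OF K'[OF that]]] that by blast
    then obtain k where "k' = b (D' k') k" "k \<in> K" "D k = D' k'" by blast
    then show ?thesis unfolding \<pi>_def by (intro image_eqI[of _ _ k]) simp_all
  qed
  ultimately have "bij_betw \<pi> K K'" using \<pi> unfolding bij_betw_def by blast
  with \<pi> show ?thesis by blast
qed

text \<open>Labels are compared only off the roots, as in \<open>vertex_unique\<close>. A relation
  allows existence and uniqueness to be shown on either side before a bijection is chosen.\<close>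

definition corresponds ::
  "(nat \<Rightarrow> nat) \<Rightarrow> (nat \<Rightarrow> nat) \<Rightarrow> (nat \<Rightarrow> nat) \<Rightarrow> (nat \<Rightarrow> nat) \<Rightarrow> (nat \<Rightarrow> nat) \<Rightarrow> (nat \<Rightarrow> nat) \<Rightarrow>
   (nat \<Rightarrow> nat) \<Rightarrow> nat \<Rightarrow> nat \<Rightarrow> bool" where
  "corresponds \<pi> owner label height owner' label' height' v w \<longleftrightarrow>
     (if v = 0 then w = 0 else w \<noteq> 0 \<and> owner' w = \<pi> (owner v) \<and> height' w = height v \<and>
       (height v = 0 \<or> label' w = label v))"

text \<open>Component, height and, off the roots, label determine a vertex and its edges, so a
  matching of components with equal label sets extends to the vertices.\<close>

lemma bouquet_iso:
  assumes "bouquet E owner label height D n" and "bouquet E' owner' label' height' D' n"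
    and \<pi>: "bij_betw \<pi> (owner ` {v. v \<noteq> 0}) (owner' ` {v. v \<noteq> 0})"
    and D: "\<And>v. v \<noteq> 0 \<Longrightarrow> D' (\<pi> (owner v)) = D (owner v)"
  shows "\<exists>f. bij f \<and> (\<forall>u v. E' (f u) (f v) \<longleftrightarrow> E u v)"
proof -
  interpret A: bouquet E owner label height D n by fact
  interpret B: bouquet E' owner' label' height' D' n by fact
  let ?R = "corresponds \<pi> owner label height owner' label' height'"
  have inj: "owner u = owner v" if "\<pi> (owner u) = \<pi> (owner v)" "u \<noteq> 0" "v \<noteq> 0" for u v
    using inj_onD[OF bij_betw_imp_inj_on[OF \<pi>] that(1)] that(2,3) by simp
  have ex: "\<exists>w. ?R v w" for v
  proof (cases "v = 0")
    case False
    then have "\<pi> (owner v) \<in> owner' ` {v. v \<noteq> 0}" using bij_betwE[OF \<pi>] by blast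
    then obtain w0 where w0: "w0 \<noteq> 0" "owner' w0 = \<pi> (owner v)" by auto
    show ?thesis
    proof (cases "height v = 0")
      case True
      with B.ex_root[OF w0(1)] w0(2) False show ?thesis unfolding corresponds_def by auto
    next
      case h: False
      then have "label v \<in> D' (owner' w0)" "height v \<le> Suc (label v)"
        using A.inner[OF False] D[OF False] w0(2) by auto
      with B.ex_inner[OF w0(1), of "label v" "height v"] h w0(2) False
      show ?thesis unfolding corresponds_def by auto
    qed
  qed (simp add: corresponds_def)
  have ex': "\<exists>v. ?R v w" for w
  proof (cases "w = 0")
    case False
    then have "owner' w \<in> \<pi> ` owner ` {v. v \<noteq> 0}" using bij_betw_imp_surj_on[OF \<pi>] by blast
    then obtain v0 where v0: "v0 \<noteq> 0" "owner' w = \<pi> (owner v0)" by auto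
    show ?thesis
    proof (cases "height' w = 0")
      case True
      with A.ex_root[OF v0(1)] v0(2) False show ?thesis unfolding corresponds_def by metis
    next
      case h: False
      then have "label' w \<in> D (owner v0)" "height' w \<le> Suc (label' w)"
        using B.inner[OF False] D[OF v0(1)] v0(2) by auto
      with A.ex_inner[OF v0(1), of "label' w" "height' w"] h obtain u
        where "u \<noteq> 0" "owner u = owner v0" "label u = label' w" "height u = height' w" by auto
      with False v0(2) show ?thesis unfolding corresponds_def by metis
    qed
  qed (auto simp: corresponds_def)
  have right_unique: "w = w'" if "?R v w" "?R v w'" for v w w'
  proof (cases "v = 0")
    case False
    with that show ?thesis unfolding corresponds_def
      by - (rule B.vertex_unique; auto)
  qed (use that in \<open>simp add: corresponds_def\<close>)
  have left_unique: "v = v'" if "?R v w" "?R v' w" for v v' w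
  proof (cases "w = 0")
    case True
    with that show ?thesis by (auto simp: corresponds_def split: if_splits)
  next
    case False
    with that have nz: "v \<noteq> 0" "v' \<noteq> 0" by (auto simp: corresponds_def split: if_splits)
    with that have eq: "\<pi> (owner v) = \<pi> (owner v')" "height v = height v'"
      "height v' = 0 \<or> label v = label v'" by (auto simp: corresponds_def)
    from A.vertex_unique[OF nz inj[OF eq(1) nz] eq(2,3)] show ?thesis .
  qed
  have edges: "E' w w' \<longleftrightarrow> E v v'" if R: "?R v w" "?R v' w'" for v w v' w'
  proof -
    have 0: "w = 0 \<longleftrightarrow> v = 0" "w' = 0 \<longleftrightarrow> v' = 0" using R
      by (auto simp: corresponds_def split: if_splits)
    show ?thesis
    proof (cases "v' = 0")
      case True
      with 0 show ?thesis by (simp add: A.edge_hub B.edge_hub)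
    next
      case v': False
      with 0 R have w': "w' \<noteq> 0" "owner' w' = \<pi> (owner v')" "height' w' = height v'"
        "height v' = 0 \<or> label' w' = label v'" by (simp_all add: corresponds_def)
      show ?thesis
      proof (cases "v = 0")
        case True
        with 0 v' w' show ?thesis by (auto simp: A.hub_edge B.hub_edge D)
      next
        case v: False
        with 0 R have w: "w \<noteq> 0" "owner' w = \<pi> (owner v)" "height' w = height v"
          "height v = 0 \<or> label' w = label v" by (simp_all add: corresponds_def)
        have "owner' w = owner' w' \<longleftrightarrow> owner v = owner v'"
          using w(2) w'(2) inj[OF _ v v'] by auto
        with v v' w w' show ?thesis by (auto simp: A.edge B.edge)
      qed
    qed
  qed
  obtain f where f: "\<And>v. ?R v (f v)" using ex by metis
  have "inj f"
  proof (rule injI)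
    fix u v assume "f u = f v"
    with f[of u] f[of v] show "u = v" by (intro left_unique[of u "f v" v]) simp_all
  qed
  moreover have "surj f"
  proof (rule surjI)
    show "f (SOME v. ?R v w) = w" for w
      using right_unique[OF f someI_ex[OF ex'[of w]]] .
  qed
  ultimately have "bij f" by (rule bijI)
  with edges f show ?thesis by blast
qed

section \<open>The bouquet of a family of decreasing approximations\<close>

text \<open>Vertex \<open>Suc w\<close> with \<open>w = \<langle>x, \<langle>s, j\<rangle>\<rangle>\<close> is the inner vertex at height \<open>j\<close> of the path that
  component \<open>x\<close> receives when \<open>g x\<close> takes a new value at stage \<open>s\<close>. Every other \<open>Suc w\<close> is the root
  of the component with index \<open>w\<close>; it has paths only if \<open>w = \<langle>x, 0\<rangle>\<close>. In this way no natural number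
  is left over.\<close>

definition on_path :: "(nat \<Rightarrow> nat \<Rightarrow> nat) \<Rightarrow> nat \<Rightarrow> bool" where
  "on_path g w \<longleftrightarrow> (pfst (psnd w) = 0 \<or> g (pfst w) (pfst (psnd w)) \<noteq> g (pfst w) (pfst (psnd w) - 1)) \<and>
     0 < psnd (psnd w) \<and> psnd (psnd w) \<le> Suc (g (pfst w) (pfst (psnd w)))"

definition owner_of :: "(nat \<Rightarrow> nat \<Rightarrow> nat) \<Rightarrow> nat \<Rightarrow> nat" where
  "owner_of g v = (if on_path g (v - 1) then prod_encode (pfst (v - 1), 0) else v - 1)"

definition label_of :: "(nat \<Rightarrow> nat \<Rightarrow> nat) \<Rightarrow> nat \<Rightarrow> nat" where
  "label_of g v = (if on_path g (v - 1) then g (pfst (v - 1)) (pfst (psnd (v - 1))) else 0)"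

definition height_of :: "(nat \<Rightarrow> nat \<Rightarrow> nat) \<Rightarrow> nat \<Rightarrow> nat" where
  "height_of g v = (if on_path g (v - 1) then psnd (psnd (v - 1)) else 0)"

definition labels :: "(nat \<Rightarrow> nat \<Rightarrow> nat) \<Rightarrow> nat \<Rightarrow> nat set" where
  "labels g k = (if psnd k = 0 then range (g (pfst k)) else {})"

text \<open>The test \<open>psnd (owner_of g v) \<noteq> 0\<close> is the decidable form of
  \<open>labels g (owner_of g v) = {}\<close>, since ranges are nonempty.\<close>

definition bouquet_edge :: "(nat \<Rightarrow> nat \<Rightarrow> nat) \<Rightarrow> nat \<Rightarrow> nat \<Rightarrow> bool" where
  "bouquet_edge g u v \<longleftrightarrow> (if v = 0 then u \<noteq> 0 else if u = 0
     then (if height_of g v = 0 then psnd (owner_of g v) \<noteq> 0 else height_of g v = Suc (label_of g v))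
     else owner_of g u = owner_of g v \<and> height_of g u = Suc (height_of g v) \<and>
       (height_of g v = 0 \<or> label_of g u = label_of g v))"

definition bouquet_graph :: "(nat \<Rightarrow> nat \<Rightarrow> nat) \<Rightarrow> nat pair_pre_digraph" where
  "bouquet_graph g = \<lparr>pverts = UNIV, parcs = {(u, v). bouquet_edge g u v}\<rparr>"

lemma pverts_bouquet_graph [simp]: "pverts (bouquet_graph g) = UNIV"
  and arc_bouquet_graph [simp]: "arc (bouquet_graph g) u v \<longleftrightarrow> bouquet_edge g u v"
  by (simp_all add: bouquet_graph_def)

lemma psnd_0 [simp]: "psnd 0 = 0"
  using psnd_encode[of 0 0] by (simp add: prod_encode_def)

text \<open>Such a code decodes to height 0, because \<open>psnd 0 = 0\<close>; so roots of
  components with paths are never taken for inner vertices.\<close>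

lemma not_on_path_root [simp]: "psnd w = 0 \<Longrightarrow> \<not> on_path g w"
  by (simp add: on_path_def)

section \<open>Label sets enumerated by decreasing stages\<close>

locale staged =
  fixes g :: "nat \<Rightarrow> nat \<Rightarrow> nat" and n :: nat
  assumes decreasing: "g x (Suc s) \<le> g x s" and few_values: "card (range (g x)) \<le> Suc n"
begin

lemma finite_values: "finite (range (g x))"
proof -
  have "g x s \<le> g x 0" for s by (rule lift_Suc_antimono_le[of "g x", OF decreasing]) simp
  then have "range (g x) \<subseteq> {..g x 0}" by auto
  then show ?thesis by (rule finite_subset) simp
qed

text \<open>The stages at which \<open>g x\<close> has a given value form an interval, of which only
  the first is new; so no value gives two paths.\<close>

lemma new_stage_unique:
  assumes "s = 0 \<or> g x s \<noteq> g x (s - 1)" "t = 0 \<or> g x t \<noteq> g x (t - 1)" "g x s = g x t"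
  shows "s = t"
proof -
  have less: "g x b < g x a" if ab: "a < b" and new: "b = 0 \<or> g x b \<noteq> g x (b - 1)" for a b
  proof -
    obtain c where c: "b = Suc c" using ab gr0_implies_Suc[of b] by auto
    have "g x c \<le> g x a"
      using ab c by (intro lift_Suc_antimono_le[of "g x", OF decreasing]) simp
    with decreasing[of x c] new c show ?thesis by simp
  qed
  show ?thesis using less[of s t] less[of t s] assms by (metis less_irrefl linorder_neqE_nat)
qed

sublocale bouquet "bouquet_edge g" "owner_of g" "label_of g" "height_of g" "labels g" n
proof
  show "bouquet_edge g u 0 \<longleftrightarrow> u \<noteq> 0" for u by (simp add: bouquet_edge_def)
  show "bouquet_edge g 0 v \<longleftrightarrow> (if height_of g v = 0 then labels g (owner_of g v) = {}
    else height_of g v = Suc (label_of g v))" if "v \<noteq> 0" for v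
    using that by (simp add: bouquet_edge_def labels_def)
  show "bouquet_edge g u v \<longleftrightarrow> owner_of g u = owner_of g v \<and> height_of g u = Suc (height_of g v) \<and>
    (height_of g v = 0 \<or> label_of g u = label_of g v)" if "u \<noteq> 0" "v \<noteq> 0" for u v
    using that by (simp add: bouquet_edge_def)
  show "label_of g v \<in> labels g (owner_of g v) \<and> height_of g v \<le> Suc (label_of g v)"
    if "v \<noteq> 0" "0 < height_of g v" for v
    using that by (auto simp: height_of_def label_of_def owner_of_def labels_def on_path_def
        split: if_splits)
  show "u = v" if uv: "u \<noteq> 0" "v \<noteq> 0" "owner_of g u = owner_of g v"
    and h: "height_of g u = height_of g v" and l: "height_of g v = 0 \<or> label_of g u = label_of g v" for u v
  proof -
    have pos: "on_path g (w - 1) \<longleftrightarrow> height_of g w \<noteq> 0" for w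
      by (auto simp: height_of_def on_path_def)
    have "u - 1 = v - 1"
    proof (cases "height_of g v = 0")
      case True
      with pos[of u] pos[of v] h uv(3) show ?thesis by (simp add: owner_of_def)
    next
      case False
      with pos[of u] pos[of v] h have on: "on_path g (u - 1)" "on_path g (v - 1)" by auto
      have x: "pfst (u - 1) = pfst (v - 1)" using uv(3) on by (simp add: owner_of_def)
      have j: "psnd (psnd (u - 1)) = psnd (psnd (v - 1))" using h on by (simp add: height_of_def)
      have "g (pfst (v - 1)) (pfst (psnd (u - 1))) = g (pfst (v - 1)) (pfst (psnd (v - 1)))"
        using l False on x by (simp add: label_of_def)
      with on x have "pfst (psnd (u - 1)) = pfst (psnd (v - 1))"
        unfolding on_path_def by (metis new_stage_unique)
      with j x show ?thesis by (metis prod_encode_pfst_psnd)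
    qed
    with uv show ?thesis by simp
  qed
  show "\<exists>u. u \<noteq> 0 \<and> owner_of g u = owner_of g v \<and> height_of g u = 0" if "v \<noteq> 0" for v
    \<comment> \<open>A value of \<open>owner_of\<close> never codes an inner vertex, so its
      successor is a root.\<close>
    by (rule exI[of _ "Suc (owner_of g v)"]) (simp add: owner_of_def height_of_def)
  show "\<exists>u. u \<noteq> 0 \<and> owner_of g u = owner_of g v \<and> label_of g u = a \<and> height_of g u = j"
    if "v \<noteq> 0" "a \<in> labels g (owner_of g v)" "0 < j" "j \<le> Suc a" for v a j
  proof -
    define x where "x = pfst (owner_of g v)"
    have "psnd (owner_of g v) = 0" and a: "a \<in> range (g x)"
      using that(2) by (auto simp: labels_def x_def split: if_splits)
    then have k: "owner_of g v = prod_encode (x, 0)"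
      unfolding x_def by (metis prod_encode_pfst_psnd)
    \<comment> \<open>The first stage with value \<open>a\<close> is a new one, so the path with
      label \<open>a\<close> is attached there.\<close>
    define s where "s = (LEAST s. g x s = a)"
    have gs: "g x s = a" unfolding s_def by (rule LeastI_ex) (use a in auto)
    have "s = 0 \<or> g x s \<noteq> g x (s - 1)"
    proof (rule disjCI)
      assume "\<not> g x s \<noteq> g x (s - 1)"
      then have "s \<le> s - 1" using gs unfolding s_def by (intro Least_le) simp
      then show "s = 0" by simp
    qed
    with that gs show ?thesis unfolding k
      by (intro exI[of _ "Suc (prod_encode (x, prod_encode (s, j)))"])
        (simp add: owner_of_def label_of_def height_of_def on_path_def)
  qed
  show "finite (labels g k)" for k by (simp add: labels_def finite_values)
  show "card (labels g k) \<le> Suc n" for k by (simp add: labels_def few_values)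
qed

lemma owner_of_Suc: "\<not> on_path g k \<Longrightarrow> owner_of g (Suc k) = k"
  by (simp add: owner_of_def)

end

text \<open>The empty set is left out because ranges are nonempty; the bare roots of a bouquet
  supply it.\<close>

definition universal :: "nat \<Rightarrow> (nat \<Rightarrow> nat \<Rightarrow> nat) \<Rightarrow> bool" where
  "universal n g \<longleftrightarrow>
     (\<forall>S. finite S \<and> S \<noteq> {} \<and> card S \<le> Suc n \<longrightarrow> infinite {x. range (g x) = S})"

lemma (in staged) infinite_components:
  assumes univ: "universal n g" and S: "finite S" "card S \<le> Suc n"
  shows "infinite {k \<in> owner_of g ` {v. v \<noteq> 0}. labels g k = S}"
proof -
  \<comment> \<open>For the empty set, the second part \<open>prod_encode (Suc 0, 0)\<close> is
    nonzero, hence no labels, and its height entry is 0, hence a root.\<close>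
  define P where "P = (if S = {} then {prod_encode (x, prod_encode (Suc 0, 0)) | x. True}
    else (\<lambda>x. prod_encode (x, 0)) ` {x. range (g x) = S})"
  have "infinite P"
  proof (cases "S = {}")
    case True
    have "inj (\<lambda>x. prod_encode (x, prod_encode (Suc 0, 0)))" by (rule injI) simp
    then show ?thesis using True by (simp add: P_def full_SetCompr_eq finite_image_iff)
  next
    case False
    have "inj (\<lambda>x. prod_encode (x, 0))" by (rule injI) simp
    then show ?thesis
      using False S univ unfolding universal_def P_def
      by (auto simp: finite_image_iff inj_on_subset)
  qed
  moreover have "P \<subseteq> {k \<in> owner_of g ` {v. v \<noteq> 0}. labels g k = S}"
  proof
    fix k assume k: "k \<in> P"
    have "prod_encode (Suc 0, 0) \<noteq> 0" by (simp add: prod_encode_def)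
    then have "psnd (psnd k) = 0" "labels g k = S"
      using k by (auto simp: P_def labels_def split: if_splits)
    then have "\<not> on_path g k" "labels g k = S" by (auto simp: on_path_def)
    moreover from owner_of_Suc[OF this(1)] have "k \<in> owner_of g ` {v. v \<noteq> 0}"
      by (intro image_eqI[of _ _ "Suc k"]) simp_all
    ultimately show "k \<in> {k \<in> owner_of g ` {v. v \<noteq> 0}. labels g k = S}" by simp
  qed
  ultimately show ?thesis using infinite_super by blast
qed

text \<open>In both bouquets every finite set of at most \<open>Suc n\<close> labels belongs to
  infinitely many components, so the components can be matched by label set.\<close>

lemma universal_bouquets_iso:
  assumes "staged g n" "staged g' n" and univ: "universal n g" "universal n g'"
  shows "\<exists>f. bij f \<and> (\<forall>u v. bouquet_edge g' (f u) (f v) \<longleftrightarrow> bouquet_edge g u v)"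
proof -
  interpret A: staged g n by fact
  interpret B: staged g' n by fact
  let ?T = "{S. finite S \<and> card S \<le> Suc n}"
  have "\<exists>\<pi>. bij_betw \<pi> (owner_of g ` {v. v \<noteq> 0}) (owner_of g' ` {v. v \<noteq> 0}) \<and>
      (\<forall>k\<in>owner_of g ` {v. v \<noteq> 0}. labels g' (\<pi> k) = labels g k)"
    by (rule ex_bij_betw_same_type[where T = ?T])
      (use A.finite_D A.card_D B.finite_D B.card_D A.infinite_components[OF univ(1)]
        B.infinite_components[OF univ(2)] in simp_all)
  then obtain \<pi> where "bij_betw \<pi> (owner_of g ` {v. v \<noteq> 0}) (owner_of g' ` {v. v \<noteq> 0})"
    "\<And>v. v \<noteq> 0 \<Longrightarrow> labels g' (\<pi> (owner_of g v)) = labels g (owner_of g v)" by blast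
  with bouquet_iso[OF A.bouquet_axioms B.bouquet_axioms] show ?thesis by blast
qed

section \<open>A universal family\<close>

text \<open>The running minimum of the entries 0 to \<open>n\<close> of the sequence coded by
  \<open>t\<close>. Thus every number \<open>t\<close> yields an admissible approximation.\<close>

definition universal_fam :: "nat \<Rightarrow> nat \<Rightarrow> nat \<Rightarrow> nat" where
  "universal_fam n t s =
     rec_nat (seq_nth t 0) (\<lambda>i y. if i < n then min y (seq_nth t (Suc i)) else y) s"

lemma universal_fam_decreasing: "universal_fam n t (Suc s) \<le> universal_fam n t s"
  by (simp add: universal_fam_def)

lemma universal_fam_const: "n \<le> s \<Longrightarrow> universal_fam n t s = universal_fam n t n"
  by (induction s rule: dec_induct) (simp_all add: universal_fam_def)

lemma universal_fam_antimono_seq: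
  assumes "\<forall>i\<le>n. seq_nth t i = a i" "antimono a"
  shows "universal_fam n t s = a (min s n)"
proof (induction s)
  case (Suc s)
  then show ?case using assms antimonoD[OF assms(2), of s "Suc s"]
    by (cases "s < n") (auto simp: universal_fam_def min_def)
qed (use assms in \<open>simp add: universal_fam_def\<close>)

lemma range_universal_fam: "range (universal_fam n t) = universal_fam n t ` {..n}"
proof -
  have "universal_fam n t s \<in> universal_fam n t ` {..n}" for s
    using universal_fam_const[of n s t] by (cases "s \<le> n") auto
  then show ?thesis by blast
qed

lemma ex_universal_fam_range:
  assumes "finite S" "S \<noteq> {}" "card S \<le> Suc n"
  shows "\<exists>t. range (universal_fam n t) = S"
proof -
  define L where "L = rev (sorted_list_of_set S)"
  have L: "set L = S" "length L = card S" "0 < length L" "sorted (rev L)"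
    using assms by (auto simp: L_def card_gt_0_iff)
  \<comment> \<open>The elements in decreasing order, the least one repeated forever; as
    \<open>card S \<le> Suc n\<close>, all occur by stage \<open>n\<close>.\<close>
  define a where "a i = L ! min i (length L - 1)" for i
  have "antimono a"
  proof (rule antimonoI)
    fix i j :: nat assume "i \<le> j"
    then have "min i (length L - 1) \<le> min j (length L - 1)" "min j (length L - 1) < length L"
      using L(3) by linarith+
    then show "a j \<le> a i" unfolding a_def by (rule sorted_rev_nth_mono[OF L(4)])
  qed
  obtain t where "\<forall>i\<le>n. seq_nth t i = a i" using ex_seq_code by blast
  then have fam: "universal_fam n t s = a (min s n)" for s
    using \<open>antimono a\<close> by (rule universal_fam_antimono_seq)
  have "range (universal_fam n t) = set L"
  proof
    show "range (universal_fam n t) \<subseteq> set L" using L(3) by (auto simp: fam a_def min_less_iff_disj)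
    show "set L \<subseteq> range (universal_fam n t)"
    proof
      fix y assume "y \<in> set L"
      then obtain i where i: "i < length L" "y = L ! i" by (metis in_set_conv_nth)
      moreover have "min (min i n) (length L - 1) = i" using i(1) assms(3) L(2) by linarith
      ultimately have "y = universal_fam n t i" by (simp add: fam a_def)
      then show "y \<in> range (universal_fam n t)" by blast
    qed
  qed
  with L(1) show ?thesis by blast
qed

text \<open>First part 0 carries \<open>g\<close>; every positive first part carries a full copy of
  the universal family, so each label set occurs infinitely often.\<close>

definition padded :: "nat \<Rightarrow> (nat \<Rightarrow> nat \<Rightarrow> nat) \<Rightarrow> nat \<Rightarrow> nat \<Rightarrow> nat" where
  "padded n g x s = (if pfst x = 0 then g (psnd x) s else universal_fam n (psnd x) s)"

lemma universal_padded: "universal n (padded n g)"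
  unfolding universal_def
proof (intro allI impI)
  fix S :: "nat set" assume "finite S \<and> S \<noteq> {} \<and> card S \<le> Suc n"
  then obtain t where t: "range (universal_fam n t) = S" using ex_universal_fam_range by blast
  have "inj (\<lambda>i. prod_encode (Suc i, t))" by (rule injI) simp
  then have "infinite (range (\<lambda>i. prod_encode (Suc i, t)))" by (rule range_inj_infinite)
  moreover have "range (\<lambda>i. prod_encode (Suc i, t)) \<subseteq> {x. range (padded n g x) = S}"
    using t by (auto simp: padded_def)
  ultimately show "infinite {x. range (padded n g x) = S}" using infinite_super by blast
qed

lemma staged_padded:
  assumes "\<And>x s. g x (Suc s) \<le> g x s" and "\<And>x. finite {s. g x s \<noteq> g x (Suc s)}"
    and "\<And>x. card {s. g x s \<noteq> g x (Suc s)} \<le> n"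
  shows "staged (padded n g) n"
proof
  show "padded n g x (Suc s) \<le> padded n g x s" for x s
    using assms(1) universal_fam_decreasing by (simp add: padded_def)
  show "card (range (padded n g x)) \<le> Suc n" for x
  proof (cases "pfst x = 0")
    case True
    let ?C = "{s. g (psnd x) s \<noteq> g (psnd x) (Suc s)}"
    let ?I = "(\<lambda>s. g (psnd x) (Suc s)) ` ?C"
    have "padded n g x = g (psnd x)" using True by (simp add: padded_def fun_eq_iff)
    then have "card (range (padded n g x)) \<le> card (insert (g (psnd x) 0) ?I)"
      using range_subset_changes[of "g (psnd x)"] assms(2)[of "psnd x"]
      by (simp only:) (rule card_mono; simp)
    also have "\<dots> \<le> Suc (card ?I)" by (rule card_insert_le_m1) simp_all
    also have "card ?I \<le> card ?C" by (rule card_image_le[OF assms(2)])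
    also have "card ?C \<le> n" by (rule assms(3))
    finally show ?thesis by simp
  next
    case False
    then have "padded n g x = universal_fam n (psnd x)" by (simp add: padded_def fun_eq_iff)
    then show ?thesis using card_image_le[of "{..n}" "universal_fam n (psnd x)"]
      by (simp add: range_universal_fam)
  qed
qed

lemma computable_padded:
  assumes "computable2 g"
  shows "computable2 (padded n g)"
  unfolding computable2_iff_recf padded_def universal_fam_def
  by (intro recf_intros recf_seq_nth recf_comp2[OF assms]) auto

section \<open>Computability of the bouquet\<close>

lemma decf_on_path:
  assumes g: "computable2 g" and A: "recf n A"
  shows "decf n (\<lambda>e. on_path g (A e))"
  unfolding on_path_def by (intro recf_intros recf_comp2[OF g] A)

lemma recf_owner_of:
  assumes g: "computable2 g" and A: "recf n A"
  shows "recf n (\<lambda>e. owner_of g (A e))"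
  unfolding owner_of_def by (intro recf_intros decf_on_path g A)

lemma recf_label_of:
  assumes g: "computable2 g" and A: "recf n A"
  shows "recf n (\<lambda>e. label_of g (A e))"
  unfolding label_of_def by (intro recf_intros decf_on_path recf_comp2[OF g] g A)

lemma recf_height_of:
  assumes g: "computable2 g" and A: "recf n A"
  shows "recf n (\<lambda>e. height_of g (A e))"
  unfolding height_of_def by (intro recf_intros decf_on_path g A)

lemma computable_bouquet_graph:
  assumes "computable2 g"
  shows "computable_digraph (bouquet_graph g)"
proof -
  have "computable2 (\<lambda>x y. of_bool (bouquet_edge g x y))"
    unfolding computable2_iff_recf bouquet_edge_def
    by (intro recf_intros recf_owner_of recf_label_of recf_height_of assms) auto
  then show ?thesis
    unfolding computable_digraph_def pair_wf_digraph_def by simp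
qed

context staged
begin

lemma recf_gap:
  assumes "computable2 g" "recf k M" "recf k U" "recf k V"
  shows "recf k (\<lambda>e. gap (M e) (U e) (V e))"
proof -
  \<comment> \<open>Emptiness of a label set becomes a test on the index, to which the closure rules
    apply.\<close>
  have "labels g x = {} \<longleftrightarrow> psnd x \<noteq> 0" for x by (simp add: labels_def)
  then show ?thesis
    unfolding gap_def detour_def
    by (simp only:) (intro recf_intros recf_owner_of recf_label_of recf_height_of assms)
qed

lemma strongly_connected_bouquet: "strongly_connected (with_proj (bouquet_graph g))"
proof (rule strongly_connectedI)
  fix u v
  obtain k where "(bouquet_edge g ^^ k) u v" using gap_dist(1) by blast
  then show "u \<rightarrow>\<^sup>*\<^bsub>with_proj (bouquet_graph g)\<^esub> v"
  proof (induction k arbitrary: u)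
    case (Suc k)
    from relpowp_Suc_D2[OF Suc.prems] obtain z where "bouquet_edge g u z" "(bouquet_edge g ^^ k) z v"
      by blast
    with Suc.IH[of z] show ?case
      unfolding reachable_def
      by (intro converse_rtrancl_on_into_rtrancl_on[of u z]) (auto simp: bouquet_graph_def)
  qed (simp add: reachable_def)
qed simp

end

section \<open>Reductions with one query\<close>

text \<open>The canonical index of \<open>{k}\<close> is \<open>2 ^ k\<close>, so this decodes
  singletons; the inequality makes the search end for every argument.\<close>

definition log2 :: "nat \<Rightarrow> nat" where "log2 r = (LEAST k. r \<le> 2 ^ k)"

lemma log2_power [simp]: "log2 (2 ^ k) = k"
  unfolding log2_def by (rule Least_equality) simp_all

lemma computable_log2: "computable1 log2"
  unfolding computable1_iff_recf log2_def
proof (rule recf_Least)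
  show "decf (Suc (Suc 0)) (\<lambda>e. \<not> e (Suc 0) \<le> 2 ^ e 0)" by (intro recf_intros) auto
  show "\<exists>k. e 0 \<le> 2 ^ k" for e :: "nat \<Rightarrow> nat" by (rule exI[of _ "e 0"]) (simp add: less_imp_le)
qed

text \<open>The query set \<open>{i x}\<close> has index \<open>2 ^ i x\<close>. The answer arrives
  as 2 to the power of a pair code, and \<open>log2\<close> followed by \<open>psnd\<close> extracts
  it.\<close>

lemma btt1_leI:
  assumes i: "computable1 i" and q: "computable2 q" and \<alpha>: "\<And>x. \<alpha> x = q x (\<beta> (i x))"
  shows "btt1_le \<alpha> \<beta>"
  unfolding btt1_le_def
proof (intro exI conjI allI)
  have dec: "set_decode (2 ^ j) = {j}" for j
    using set_encode_inverse[of "{j}"] by (simp add: set_encode_def)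
  show "computable1 (\<lambda>x. 2 ^ i x)"
    unfolding computable1_iff_recf by (intro recf_intros recf_comp1[OF i]) auto
  show "computable2 (\<lambda>x r. q x (psnd (log2 r)))"
    unfolding computable2_iff_recf
    by (intro recf_intros recf_comp2[OF q] recf_comp1[OF computable_log2]) auto
  show "card (set_decode (2 ^ i x)) \<le> 1" for x by (simp add: dec)
  show "\<alpha> x = q x (psnd (log2 (restr_code \<beta> (set_decode (2 ^ i x)))))" for x
    by (simp add: dec \<alpha> restr_code_def set_encode_def)
qed

text \<open>A convergent sequence of numbers is eventually constant, and a decreasing one never
  falls below its limit. So the least label of a component with paths is the limit of its
  approximation.\<close>

lemma (in staged) Min_range_eq_limit:
  assumes "g x \<longlonglongrightarrow> l"
  shows "Min (range (g x)) = l"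
proof -
  have "eventually (\<lambda>s. g x s \<in> {l}) sequentially"
    using topological_tendstoD[OF assms, of "{l}"] by (simp add: open_discrete)
  then obtain N where N: "\<And>s. N \<le> s \<Longrightarrow> g x s = l" by (auto simp: eventually_sequentially)
  have "l \<le> g x s" for s
  proof -
    have "g x (max N s) \<le> g x s" by (rule lift_Suc_antimono_le[of "g x", OF decreasing]) simp
    with N[of "max N s"] show ?thesis by simp
  qed
  then show ?thesis using N[of N] finite_values by (intro Min_eqI) (auto intro: range_eqI)
qed

lemma padded_limit:
  assumes "g (psnd x) \<longlonglongrightarrow> l"
  shows "padded n g x \<longlonglongrightarrow> (if pfst x = 0 then l else universal_fam n (psnd x) n)"
proof (cases "pfst x = 0")
  case True
  then have "padded n g x = g (psnd x)" by (simp add: padded_def fun_eq_iff)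
  with True assms show ?thesis by simp
next
  case False
  have "padded n g x s = universal_fam n (psnd x) n" if "n \<le> s" for s
    using universal_fam_const[OF that, of "psnd x"] False by (simp add: padded_def)
  then have "eventually (\<lambda>s. padded n g x s = universal_fam n (psnd x) n) sequentially"
    unfolding eventually_sequentially by blast
  with False show ?thesis by (simp add: tendsto_eventually)
qed

text \<open>The value \<open>f x\<close> is read off the distance from the hub to one root.
  Conversely, the component of the target tells which value of \<open>f\<close> can be its least
  label, and \<open>gap\<close> computes the distance from that label.\<close>

lemma btt1_equiv_bouquet:
  assumes g: "computable2 g" and lim: "\<And>x. g x \<longlonglongrightarrow> f x"
    and staged: "staged (padded n g) n"
  shows "btt1_equiv f (distance_function (bouquet_graph (padded n g)))"
proof -
  define G where "G = padded n g"
  interpret staged G n using staged by (simp add: G_def)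
  have G: "computable2 G" unfolding G_def using g by (rule computable_padded)
  have Min_range: "Min (range (G x)) = (if pfst x = 0 then f (psnd x) else universal_fam n (psnd x) n)"
    for x unfolding G_def
    by (rule Min_range_eq_limit[unfolded G_def, OF padded_limit[of g, OF lim]])
  have dist: "distance_function (bouquet_graph G) z =
      gap (Min (labels G (owner_of G (psnd z)))) (pfst z) (psnd z)" for z
    by (simp add: distance_function_eq_walk_dist gap_dist(2))
  \<comment> \<open>The last 0 makes this the root of a component with paths, the first 0 selects
    the part of \<open>padded n g\<close> that carries \<open>g\<close>.\<close>
  define root where "root x = Suc (prod_encode (prod_encode (0, x), 0))" for x
  have owner_root: "owner_of G (root x) = prod_encode (prod_encode (0, x), 0)"
    and height_root: "height_of G (root x) = 0" for x
    by (simp_all add: root_def owner_of_def height_of_def)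
  have "distance_function (bouquet_graph G) (prod_encode (0, root x)) = f x + 2" for x
    by (simp add: dist owner_root height_root gap_def detour_def labels_def Min_range)
      (simp add: root_def)
  then have 1: "btt1_le f (distance_function (bouquet_graph G))"
  proof (intro btt1_leI)
    show "computable1 (\<lambda>x. prod_encode (0, root x))"
      unfolding computable1_iff_recf root_def by (intro recf_intros) auto
    show "computable2 (\<lambda>x y. y - 2)"
      unfolding computable2_iff_recf by (intro recf_intros) auto
  qed simp
  define index where "index z = pfst (owner_of G (psnd z))" for z
  have 2: "btt1_le (distance_function (bouquet_graph G)) f"
  proof (rule btt1_leI)
    show "computable1 (\<lambda>z. psnd (index z))"
      unfolding computable1_iff_recf index_def by (intro recf_intros recf_owner_of G) auto
    \<comment> \<open>In a component of the universal family the limit is the value at stage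
      \<open>n\<close>, so the answer \<open>m\<close> is ignored.\<close>
    show "computable2 (\<lambda>z m. gap (if pfst (index z) = 0 then m else universal_fam n (psnd (index z)) n)
        (pfst z) (psnd z))"
      unfolding computable2_iff_recf index_def universal_fam_def
      by (intro recf_gap recf_intros recf_seq_nth recf_owner_of G) auto
    show "distance_function (bouquet_graph G) z =
        gap (if pfst (index z) = 0 then f (psnd (index z)) else universal_fam n (psnd (index z)) n)
          (pfst z) (psnd z)" for z
    proof (cases "psnd (owner_of G (psnd z)) = 0")
      case True
      then show ?thesis by (simp add: dist labels_def Min_range index_def)
    next
      case False
      \<comment> \<open>Without labels \<open>detour\<close> does not depend on its first argument,
        so any answer gives the right distance.\<close>
      then have "detour m (psnd z) = 1" for m by (simp add: detour_def labels_def)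
      then show ?thesis unfolding dist gap_def by (simp only:)
    qed
  qed
  from 1 2 show ?thesis unfolding btt1_equiv_def G_def by blast
qed

theorem theorem6p1:
  fixes n :: nat
  shows "\<exists>G :: nat pair_pre_digraph.
    computable_digraph G \<and> strongly_connected (with_proj G) \<and>
    intrinsically_approx_from_above n G \<and>
    (\<forall>f :: nat \<Rightarrow> nat. approx_from_above n f \<longrightarrow>
       (\<exists>H. computable_digraph H \<and> isomorphic G H \<and> btt1_equiv f (distance_function H)))"
proof -
  \<comment> \<open>The zero family only adds components with label set \<open>{0}\<close>, which
    occurs infinitely often anyway.\<close>
  define z where "z = padded n (\<lambda>_ _. 0)"
  have "computable2 (\<lambda>_ _. 0)" unfolding computable2_iff_recf by (rule recf_const)
  then have z: "computable2 z" unfolding z_def by (rule computable_padded)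
  interpret staged z n unfolding z_def by (rule staged_padded) simp_all
  have 1: "computable_digraph (bouquet_graph z)" using z by (rule computable_bouquet_graph)
  have 2: "strongly_connected (with_proj (bouquet_graph z))" by (rule strongly_connected_bouquet)
  have 3: "intrinsically_approx_from_above n (bouquet_graph z)" by (rule intrinsically_approx) simp_all
  have 4: "\<exists>H. computable_digraph H \<and> isomorphic (bouquet_graph z) H \<and>
      btt1_equiv f (distance_function H)" if f: "approx_from_above n f" for f
  proof -
    from f obtain g where g: "computable2 g" "\<And>x. g x \<longlonglongrightarrow> f x" "\<And>x s. g x (Suc s) \<le> g x s"
      "\<And>x. finite {s. g x s \<noteq> g x (Suc s)}" "\<And>x. card {s. g x s \<noteq> g x (Suc s)} \<le> n"
      unfolding approx_from_above_def by blast
    let ?H = "bouquet_graph (padded n g)"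
    have st: "staged (padded n g) n" using g(3-5) by (rule staged_padded)
    have H: "computable_digraph ?H" using g(1) by (intro computable_bouquet_graph computable_padded)
    have "isomorphic (bouquet_graph z) ?H"
      using universal_bouquets_iso[OF staged_axioms st] universal_padded
      by (simp add: isomorphic_iff[OF pverts_bouquet_graph H] z_def)
    with H btt1_equiv_bouquet[OF g(1,2) st] show ?thesis by blast
  qed
  from 1 2 3 4 show ?thesis by blast
qed

end
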